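(* Let $s\in(0,1)$, let $\Omega\subset\mathbb{R}^N$ be a bounded strictly convex domain of class $C^2$, and let $f\in C(\overline\Omega)$ and $g\in C(\overline{\mathbb{R}^N\setminus\Omega})$ be bounded. Let $u,v\colon\mathbb{R}^N\to\mathbb{R}$ be, respectively, a viscosity subsolution and a viscosity supersolution (in the sense described in the context) of \[ \begin{cases} \displaystyle \Lambda_1^s u(x)\coloneqq \inf\left\{\int_{\mathbb{R}}\frac{u(x+tz)-u(x)}{|t|^{1+2s}}\,dt\colon z\in\mathbb{S}^{N-1}\right\}=f(x), & x\in\Omega,\\[6pt] u(x)=g(x), & x\in\mathbb{R}^N\setminus\Omega. \end{cases} \] Then $u\le v$ in $\mathbb{R}^N$.
   Context: Integrals are principal value integrals; $\mathbb{S}^{N-1}$ is the unit sphere. For $u\colon\overline\Omega\to\mathbb{R}$ let the upper $g$-extension be $u^g=u$ in $\Omega$, $u^g=g$ in $\mathbb{R}^N\setminus\overline\Omega$, $u^g=\max\{u,g\}$ on $\partial\Omega$; the lower $g$-extension $u_g$ uses $\min$ instead. For $\delta>0$, $z\in\mathbb{S}^{N-1}$, a $C^2$ function $\phi$ and a function $w$, set $E_{z,\delta}(w,\phi,x)\coloneqq\int_{-\delta}^{\delta}\frac{\phi(x+tz)-\phi(x)}{|t|^{1+2s}}dt+\int_{\mathbb{R}\setminus(-\delta,\delta)}\frac{w(x+tz)-u(x)}{|t|^{1+2s}}dt-f(x)$ and $E_\delta(w,\phi,x)\coloneqq-\inf_{z\in\mathbb{S}^{N-1}}E_{z,\delta}(w,\phi,x)$.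 A bounded upper semicontinuous $u\colon\mathbb{R}^N\to\mathbb{R}$ is a viscosity subsolution if $u\le g$ in $\mathbb{R}^N\setminus\overline\Omega$ and for every $\delta>0$ and $\phi\in C^2(\mathbb{R}^N)$ such that $x_0$ is a maximum point of $u-\phi$ in $B_\delta(x_0)$: $E_\delta(u^g,\phi,x_0)\le0$ if $x_0\in\Omega$, and $\min\{E_\delta(u^g,\phi,x_0),u(x_0)-g(x_0)\}\le 0$ if $x_0\in\partial\Omega$ (if $u$ is not upper semicontinuous, this is required of its upper semicontinuous envelope). Viscosity supersolutions are defined analogously, with lower semicontinuity, $u_g$, minimum points and reversed inequalities (with $\max$ instead of $\min$ on $\partial\Omega$). *)

theory Defs
  imports "HOL-Analysis.Analysis"
begin

definition C2_on :: "'a::euclidean_space set \<Rightarrow> ('a \<Rightarrow> real) \<Rightarrow> bool" where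
  "C2_on S \<phi> \<longleftrightarrow> open S \<and>
     (\<exists>(D :: 'a \<Rightarrow> 'a \<Rightarrow>\<^sub>L real) (D2 :: 'a \<Rightarrow> 'a \<Rightarrow>\<^sub>L ('a \<Rightarrow>\<^sub>L real)).
        (\<forall>x\<in>S. (\<phi> has_derivative blinfun_apply (D x)) (at x)) \<and>
        (\<forall>x\<in>S. (D has_derivative blinfun_apply (D2 x)) (at x)) \<and>
        continuous_on S D2)"

definition C2_domain :: "'a::euclidean_space set \<Rightarrow> bool" where
  "C2_domain \<Omega> \<longleftrightarrow> open \<Omega> \<and> connected \<Omega> \<and> \<Omega> \<noteq> {} \<and>
     (\<forall>x0\<in>frontier \<Omega>. \<exists>r>0. \<exists>(\<rho> :: 'a \<Rightarrow> real) (D :: 'a \<Rightarrow> 'a \<Rightarrow>\<^sub>L real)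
        (D2 :: 'a \<Rightarrow> 'a \<Rightarrow>\<^sub>L ('a \<Rightarrow>\<^sub>L real)).
        (\<forall>x\<in>ball x0 r. (\<rho> has_derivative blinfun_apply (D x)) (at x)) \<and>
        (\<forall>x\<in>ball x0 r. (D has_derivative blinfun_apply (D2 x)) (at x)) \<and>
        continuous_on (ball x0 r) D2 \<and>
        (\<forall>x\<in>ball x0 r. D x \<noteq> 0) \<and>
        \<Omega> \<inter> ball x0 r = {x\<in>ball x0 r. \<rho> x < 0})"

definition strictly_convex :: "'a::euclidean_space set \<Rightarrow> bool" where
  "strictly_convex \<Omega> \<longleftrightarrow> convex \<Omega> \<and>
     (\<forall>x\<in>closure \<Omega>. \<forall>y\<in>closure \<Omega>. x \<noteq> y \<longrightarrow> open_segment x y \<subseteq> \<Omega>)"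

definition upper_ext :: "'a::euclidean_space set \<Rightarrow> ('a \<Rightarrow> real) \<Rightarrow> ('a \<Rightarrow> real) \<Rightarrow> 'a \<Rightarrow> real" where
  "upper_ext \<Omega> g u x = (if x \<in> \<Omega> then u x else if x \<in> frontier \<Omega> then max (u x) (g x) else g x)"

definition lower_ext :: "'a::euclidean_space set \<Rightarrow> ('a \<Rightarrow> real) \<Rightarrow> ('a \<Rightarrow> real) \<Rightarrow> 'a \<Rightarrow> real" where
  "lower_ext \<Omega> g u x = (if x \<in> \<Omega> then u x else if x \<in> frontier \<Omega> then min (u x) (g x) else g x)"

definition usc_envelope :: "('a::metric_space \<Rightarrow> real) \<Rightarrow> 'a \<Rightarrow> real" where
  "usc_envelope u x = (INF e\<in>{0<..}. SUP y\<in>ball x e. u y)"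

definition lsc_envelope :: "('a::metric_space \<Rightarrow> real) \<Rightarrow> 'a \<Rightarrow> real" where
  "lsc_envelope u x = (SUP e\<in>{0<..}. INF y\<in>ball x e. u y)"

definition E_z :: "real \<Rightarrow> ('a::euclidean_space \<Rightarrow> real) \<Rightarrow> ('a \<Rightarrow> real) \<Rightarrow> ('a \<Rightarrow> real)
    \<Rightarrow> ('a \<Rightarrow> real) \<Rightarrow> real \<Rightarrow> 'a \<Rightarrow> 'a \<Rightarrow> real" where
  "E_z s f u w \<phi> \<delta> z x =
     Lim (at_right 0) (\<lambda>\<epsilon>. integral {t. \<epsilon> < \<bar>t\<bar> \<and> \<bar>t\<bar> < \<delta>}
          (\<lambda>t. (\<phi> (x + t *\<^sub>R z) - \<phi> x) / \<bar>t\<bar> powr (1 + 2 * s)))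
   + Lim at_top (\<lambda>R. integral {t. \<delta> \<le> \<bar>t\<bar> \<and> \<bar>t\<bar> \<le> R}
          (\<lambda>t. (w (x + t *\<^sub>R z) - u x) / \<bar>t\<bar> powr (1 + 2 * s)))
   - f x"

definition E_delta :: "real \<Rightarrow> ('a::euclidean_space \<Rightarrow> real) \<Rightarrow> ('a \<Rightarrow> real) \<Rightarrow> ('a \<Rightarrow> real)
    \<Rightarrow> ('a \<Rightarrow> real) \<Rightarrow> real \<Rightarrow> 'a \<Rightarrow> real" where
  "E_delta s f u w \<phi> \<delta> x = - (INF z\<in>sphere 0 1. E_z s f u w \<phi> \<delta> z x)"

definition visc_sub_usc :: "real \<Rightarrow> 'a::euclidean_space set \<Rightarrow> ('a \<Rightarrow> real) \<Rightarrow> ('a \<Rightarrow> real)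
    \<Rightarrow> ('a \<Rightarrow> real) \<Rightarrow> bool" where
  "visc_sub_usc s \<Omega> f g u \<longleftrightarrow>
     (\<forall>x. x \<notin> closure \<Omega> \<longrightarrow> u x \<le> g x) \<and>
     (\<forall>\<delta>>0. \<forall>\<phi> x0. C2_on UNIV \<phi> \<longrightarrow> (\<forall>y\<in>ball x0 \<delta>. u y - \<phi> y \<le> u x0 - \<phi> x0) \<longrightarrow>
        (x0 \<in> \<Omega> \<longrightarrow> E_delta s f u (upper_ext \<Omega> g u) \<phi> \<delta> x0 \<le> 0) \<and>
        (x0 \<in> frontier \<Omega> \<longrightarrow> min (E_delta s f u (upper_ext \<Omega> g u) \<phi> \<delta> x0) (u x0 - g x0) \<le> 0))"

definition visc_super_lsc :: "real \<Rightarrow> 'a::euclidean_space set \<Rightarrow> ('a \<Rightarrow> real) \<Rightarrow> ('a \<Rightarrow> real)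
    \<Rightarrow> ('a \<Rightarrow> real) \<Rightarrow> bool" where
  "visc_super_lsc s \<Omega> f g u \<longleftrightarrow>
     (\<forall>x. x \<notin> closure \<Omega> \<longrightarrow> u x \<ge> g x) \<and>
     (\<forall>\<delta>>0. \<forall>\<phi> x0. C2_on UNIV \<phi> \<longrightarrow> (\<forall>y\<in>ball x0 \<delta>. u y - \<phi> y \<ge> u x0 - \<phi> x0) \<longrightarrow>
        (x0 \<in> \<Omega> \<longrightarrow> E_delta s f u (lower_ext \<Omega> g u) \<phi> \<delta> x0 \<ge> 0) \<and>
        (x0 \<in> frontier \<Omega> \<longrightarrow> max (E_delta s f u (lower_ext \<Omega> g u) \<phi> \<delta> x0) (u x0 - g x0) \<ge> 0))"

text \<open>A bounded u is a viscosity subsolution if its upper semicontinuous envelope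
  (which equals u when u is usc) satisfies the conditions; dually for supersolutions.\<close>
definition visc_subsolution :: "real \<Rightarrow> 'a::euclidean_space set \<Rightarrow> ('a \<Rightarrow> real) \<Rightarrow> ('a \<Rightarrow> real)
    \<Rightarrow> ('a \<Rightarrow> real) \<Rightarrow> bool" where
  "visc_subsolution s \<Omega> f g u \<longleftrightarrow> bounded (range u) \<and> visc_sub_usc s \<Omega> f g (usc_envelope u)"

definition visc_supersolution :: "real \<Rightarrow> 'a::euclidean_space set \<Rightarrow> ('a \<Rightarrow> real) \<Rightarrow> ('a \<Rightarrow> real)
    \<Rightarrow> ('a \<Rightarrow> real) \<Rightarrow> bool" where
  "visc_supersolution s \<Omega> f g u \<longleftrightarrow> bounded (range u) \<and> visc_super_lsc s \<Omega> f g (lsc_envelope u)"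

end

theory Submission
  imports Defs "HOL-Real_Asymp.Real_Asymp"
begin

text \<open>
  Extend the upper envelopes of \<open>u\<close> and \<open>-v\<close> by \<open>g\<close> and \<open>-g\<close> to upper semicontinuous functions \<open>U\<close> and
  \<open>V\<close>, and test them with paraboloids only; it suffices that \<open>U + V \<le> 0\<close>. The equation holds
  for \<open>U\<close> in every direction \<open>z\<close>, but for \<open>V\<close>, up to an error, in just one.

  Boundary: if \<open>U > g\<close> at \<open>x0\<close>, maximise \<open>U - p\<close> over \<open>closure \<Omega>\<close>, where \<open>p\<close> is a steep supporting
  functional at \<open>x0\<close>. The affine test function does not contribute to the principal value. Pair the
  points \<open>x + tz\<close> and \<open>x - tz\<close>: if both lie in \<open>closure \<Omega>\<close>, maximality bounds the pair by 0, and
  otherwise the gap \<open>U x0 - g x0\<close> makes it strictly negative. By strict convexity the second case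
  holds for all \<open>t\<close> beyond a length that shrinks to 0, so the integral tends to \<open>-\<infinity>\<close> uniformly
  in \<open>z\<close>. Hence an equation in a single direction is already contradictory, and \<open>V\<close> is treated alike.

  Interior: double the variables with the penalty \<open>n |x - y|\<^sup>2\<close>. Along the direction provided by \<open>V\<close>
  the near part of the integrals is nonpositive by maximality, and the part outside \<open>\<Omega>\<close>, where \<open>U\<close> and
  \<open>V\<close> cancel up to the modulus of continuity of \<open>g\<close>, is bounded above by a negative constant.
\<close>

section \<open>Principal values and tails along a line\<close>

lemma integral_symmetric_annulus:
  fixes F :: "real \<Rightarrow> real"
  assumes "0 < a" and F: "F integrable_on {a..b}" "(\<lambda>t. F (- t)) integrable_on {a..b}"
    and S: "{t. a < \<bar>t\<bar> \<and> \<bar>t\<bar> < b} \<subseteq> S" "S \<subseteq> {t. a \<le> \<bar>t\<bar> \<and> \<bar>t\<bar> \<le> b}"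
  shows "integral S F = integral {a..b} (\<lambda>t. F t + F (- t))"
proof -
  have left: "(F has_integral integral {a..b} (\<lambda>t. F (- t))) {-b..-a}"
    using integrable_integral[OF F(2)] has_integral_reflect_real[of "\<lambda>t. F (- t)" _ b a] by simp
  have "{-b..-a} \<inter> {a..b} = {}"
    using assms(1) by auto
  then have "(F has_integral (integral {a..b} (\<lambda>t. F (- t)) + integral {a..b} F)) ({-b..-a} \<union> {a..b})"
    by (intro has_integral_Un left integrable_integral F(1)) auto
  then have "integral ({-b..-a} \<union> {a..b}) F = integral {a..b} (\<lambda>t. F t + F (- t))"
    using F by (simp add: integral_unique integral_add)
  moreover have "integral S F = integral ({-b..-a} \<union> {a..b}) F"
  proof (rule integral_spike_set)
    have "S - ({-b..-a} \<union> {a..b}) \<subseteq> {t. a \<le> \<bar>t\<bar> \<and> \<bar>t\<bar> \<le> b} - ({-b..-a} \<union> {a..b})"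
      by (intro Diff_mono S(2) order_refl)
    also have "\<dots> = {}"
      by auto
    finally show "negligible {t \<in> S - ({-b..-a} \<union> {a..b}). F t \<noteq> 0}"
      by (intro negligible_subset[OF negligible_empty] order_trans[OF Collect_restrict])
    have endpoints: "negligible {a, -a, b, -b}"
      by simp
    have "({-b..-a} \<union> {a..b}) - S \<subseteq> ({-b..-a} \<union> {a..b}) - {t. a < \<bar>t\<bar> \<and> \<bar>t\<bar> < b}"
      by (intro Diff_mono S(1) order_refl)
    also have "\<dots> \<subseteq> {a, -a, b, -b}"
      using assms(1) by auto
    finally show "negligible {t \<in> ({-b..-a} \<union> {a..b}) - S. F t \<noteq> 0}"
      by (intro negligible_subset[OF endpoints] order_trans[OF Collect_restrict])
  qed
  ultimately show ?thesis
    by simp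
qed

lemma has_integral_powr_Icc:
  fixes p :: real
  assumes "p \<noteq> -1" "0 < a" "a \<le> b"
  shows "((\<lambda>t. t powr p) has_integral (b powr (p + 1) - a powr (p + 1)) / (p + 1)) {a..b}"
proof -
  have "((\<lambda>t. t powr p) has_integral (b powr (p + 1) / (p + 1) - a powr (p + 1) / (p + 1))) {a..b}"
    using assms
    by (intro fundamental_theorem_of_calculus)
       (auto intro!: derivative_eq_intros
             simp flip: has_real_derivative_iff_has_vector_derivative)
  then show ?thesis
    by (simp add: diff_divide_distrib)
qed

lemma square_div_powr:
  fixes t :: real
  assumes "0 < t"
  shows "t\<^sup>2 / t powr (1 + 2 * s) = t powr (1 - 2 * s)"
proof -
  have "t\<^sup>2 / t powr (1 + 2 * s) = t powr 2 / t powr (1 + 2 * s)"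
    using assms by simp
  then show ?thesis
    by (simp flip: powr_diff)
qed

lemma integral_annulus_quadratic:
  fixes s \<delta> \<epsilon> a b :: real
  assumes "s \<noteq> 1" "0 < \<epsilon>" "\<epsilon> < \<delta>"
  shows "integral {t. \<epsilon> < \<bar>t\<bar> \<and> \<bar>t\<bar> < \<delta>} (\<lambda>t. (a * t + b * t\<^sup>2) / \<bar>t\<bar> powr (1 + 2 * s))
    = b * (\<delta> powr (2 - 2 * s) - \<epsilon> powr (2 - 2 * s)) / (1 - s)"
proof -
  let ?F = "\<lambda>t. (a * t + b * t\<^sup>2) / \<bar>t\<bar> powr (1 + 2 * s)"
  have "integral {t. \<epsilon> < \<bar>t\<bar> \<and> \<bar>t\<bar> < \<delta>} ?F = integral {\<epsilon>..\<delta>} (\<lambda>t. ?F t + ?F (- t))"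
    using assms by (intro integral_symmetric_annulus integrable_continuous_interval)
      (auto intro!: continuous_intros)
  also have "\<dots> = integral {\<epsilon>..\<delta>} (\<lambda>t. (2 * b) * t powr (1 - 2 * s))"
  proof (rule integral_cong)
    fix t assume "t \<in> {\<epsilon>..\<delta>}"
    then have "0 < t"
      using assms by auto
    then have "?F t + ?F (- t) = (2 * b) * (t\<^sup>2 / t powr (1 + 2 * s))"
      by (simp flip: add_divide_distrib)
    then show "?F t + ?F (- t) = (2 * b) * t powr (1 - 2 * s)"
      using square_div_powr[OF \<open>0 < t\<close>] by simp
  qed
  also have "\<dots> = (2 * b) * ((\<delta> powr (2 - 2 * s) - \<epsilon> powr (2 - 2 * s)) / (2 - 2 * s))"
    using has_integral_powr_Icc[of "1 - 2 * s" \<epsilon> \<delta>] assms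
    by (intro integral_unique has_integral_mult_right) (simp add: algebra_simps)
  also have "\<dots> = b * (\<delta> powr (2 - 2 * s) - \<epsilon> powr (2 - 2 * s)) / (1 - s)"
    using assms(1) by (simp add: field_simps)
  finally show ?thesis .
qed

lemma principal_value_quadratic:
  fixes s \<delta> a b :: real
  assumes "s < 1" "0 < \<delta>"
  shows "Lim (at_right 0) (\<lambda>\<epsilon>. integral {t. \<epsilon> < \<bar>t\<bar> \<and> \<bar>t\<bar> < \<delta>}
      (\<lambda>t. (a * t + b * t\<^sup>2) / \<bar>t\<bar> powr (1 + 2 * s)))
    = b * \<delta> powr (2 - 2 * s) / (1 - s)"
proof (rule tendsto_Lim)
  let ?annulus = "\<lambda>\<epsilon>. integral {t. \<epsilon> < \<bar>t\<bar> \<and> \<bar>t\<bar> < \<delta>} (\<lambda>t. (a * t + b * t\<^sup>2) / \<bar>t\<bar> powr (1 + 2 * s))"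
  let ?value = "\<lambda>\<epsilon>. b * (\<delta> powr (2 - 2 * s) - \<epsilon> powr (2 - 2 * s)) / (1 - s)"
  have "((\<lambda>\<epsilon>::real. \<epsilon> powr (2 - 2 * s)) \<longlongrightarrow> 0) (at_right 0)"
    using assms by real_asymp
  then have "(?value \<longlongrightarrow> b * (\<delta> powr (2 - 2 * s) - 0) / (1 - s)) (at_right 0)"
    using assms by (intro tendsto_intros) auto
  moreover have "\<forall>\<^sub>F \<epsilon> in at_right 0. ?value \<epsilon> = ?annulus \<epsilon>"
    using eventually_at_right_real[OF assms(2)]
    by eventually_elim (use assms integral_annulus_quadratic in auto)
  ultimately show "(?annulus \<longlongrightarrow> b * \<delta> powr (2 - 2 * s) / (1 - s)) (at_right 0)"
    by (simp add: Lim_transform_eventually)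
qed simp

definition borel_bounded :: "real \<Rightarrow> ('a::topological_space \<Rightarrow> real) \<Rightarrow> bool" where
  "borel_bounded C h \<longleftrightarrow> h \<in> borel_measurable borel \<and> (\<forall>x. \<bar>h x\<bar> \<le> C)"

lemma borel_bounded_uminus: "borel_bounded C h \<Longrightarrow> borel_bounded C (\<lambda>x. - h x)"
  by (auto simp: borel_bounded_def)

lemma borel_bounded_add:
  assumes "borel_bounded C h" "borel_bounded D k"
  shows "borel_bounded (C + D) (\<lambda>x. h x + k x)"
  using assms unfolding borel_bounded_def by (auto intro: abs_triangle_ineq[THEN order_trans] add_mono)

lemma borel_bounded_compose:
  assumes "borel_bounded C h" "continuous_on UNIV k"
  shows "borel_bounded C (\<lambda>x. h (k x))"
  using assms borel_measurable_continuous_onI[OF assms(2)]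
  by (auto simp: borel_bounded_def intro: measurable_compose)

lemma borel_bounded_increment:
  fixes w :: "'a::euclidean_space \<Rightarrow> real"
  assumes "borel_bounded C w"
  shows "borel_bounded (2 * C) (\<lambda>t. w (x + t *\<^sub>R z) - w x)"
proof -
  have "borel_bounded C (\<lambda>t. w (x + t *\<^sub>R z))"
    by (intro borel_bounded_compose[OF assms] continuous_intros)
  moreover have "borel_bounded C (\<lambda>t::real. - w x)"
    using assms by (auto simp: borel_bounded_def)
  ultimately show ?thesis
    using borel_bounded_add by fastforce
qed

lemma borel_bounded_reflect_add:
  fixes h :: "real \<Rightarrow> real"
  assumes "borel_bounded C h"
  shows "borel_bounded (2 * C) (\<lambda>t. h t + h (- t))"
proof -
  have "borel_bounded C (\<lambda>t. h (- t))"
    by (intro borel_bounded_compose[OF assms] continuous_intros)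
  then show ?thesis
    using borel_bounded_add[OF assms] by fastforce
qed

definition tail_integral :: "real \<Rightarrow> real \<Rightarrow> (real \<Rightarrow> real) \<Rightarrow> real" where
  "tail_integral s \<delta> h = integral {\<delta>..} (\<lambda>t. (h t + h (- t)) * t powr (- 1 - 2 * s))"

context
  fixes s \<delta> :: real
  assumes s: "0 < s" and \<delta>: "0 < \<delta>"
begin

lemma has_integral_tail_kernel:
  "((\<lambda>t. c * t powr (- 1 - 2 * s)) has_integral c * (\<delta> powr (- 2 * s) / (2 * s))) {\<delta>..}"
  using has_integral_mult_right[OF has_integral_powr_to_inf[of "- 1 - 2 * s" \<delta>], of c] s \<delta> by simp

lemma absolutely_integrable_tail:
  assumes "borel_bounded C h"
  shows "(\<lambda>t. h t * t powr (- 1 - 2 * s)) absolutely_integrable_on {\<delta>..}"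
proof (rule measurable_bounded_by_integrable_imp_absolutely_integrable)
  have [measurable]: "h \<in> borel_measurable borel"
    using assms by (simp add: borel_bounded_def)
  have "(\<lambda>t. h t * t powr (- 1 - 2 * s)) \<in> borel_measurable borel"
    by measurable
  then show "(\<lambda>t. h t * t powr (- 1 - 2 * s)) \<in> borel_measurable (lebesgue_on {\<delta>..})"
    by (simp add: borel_measurable_if_D measurable_completion measurable_restrict_space1)
  show "(\<lambda>t. C * t powr (- 1 - 2 * s)) integrable_on {\<delta>..}"
    using has_integral_tail_kernel by blast
  show "norm (h t * t powr (- 1 - 2 * s)) \<le> C * t powr (- 1 - 2 * s)" for t
    using assms by (simp add: abs_mult mult_right_mono borel_bounded_def)
qed simp

lemmas integrable_tail = absolutely_integrable_tail[THEN set_lebesgue_integral_eq_integral(1)]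

lemma improper_integral_eq_tail_integral:
  assumes h: "borel_bounded C h"
  shows "Lim at_top (\<lambda>R. integral {t. \<delta> \<le> \<bar>t\<bar> \<and> \<bar>t\<bar> \<le> R} (\<lambda>t. h t / \<bar>t\<bar> powr (1 + 2 * s)))
    = tail_integral s \<delta> h"
proof (rule tendsto_Lim)
  let ?F = "\<lambda>t. h t / \<bar>t\<bar> powr (1 + 2 * s)"
  let ?H = "\<lambda>t. (h t + h (- t)) * t powr (- 1 - 2 * s)"
  have kernel: "?F t = h t * t powr (- 1 - 2 * s)" "?F (- t) = h (- t) * t powr (- 1 - 2 * s)"
    if "t \<in> {\<delta>..}" for t
    using that \<delta> powr_minus_divide[of t "1 + 2 * s"] by simp_all
  have h': "borel_bounded C (\<lambda>t. h (- t))"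
    by (intro borel_bounded_compose[OF h] continuous_intros)
  have "?F integrable_on {\<delta>..}" "(\<lambda>t. ?F (- t)) integrable_on {\<delta>..}"
    using integrable_tail[OF h] integrable_tail[OF h'] kernel
    by (metis (no_types, lifting) integrable_eq)+
  then have "?F integrable_on {\<delta>..R}" "(\<lambda>t. ?F (- t)) integrable_on {\<delta>..R}" for R
    by (auto elim: integrable_on_subinterval)
  then have annulus: "integral {t. \<delta> \<le> \<bar>t\<bar> \<and> \<bar>t\<bar> \<le> R} ?F = integral {\<delta>..R} ?H" for R
    using \<delta> kernel
    by (subst integral_symmetric_annulus) (auto intro!: integral_cong simp: distrib_right)
  have H: "?H absolutely_integrable_on {\<delta>..}"
    by (rule absolutely_integrable_tail[OF borel_bounded_reflect_add[OF h]])
  have "?H absolutely_integrable_on {\<delta>..R}" for R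
    by (rule absolutely_integrable_on_subinterval[OF H]) auto
  note integral_eq = this[THEN set_lebesgue_integral_eq_integral(2)]
    H[THEN set_lebesgue_integral_eq_integral(2)]
  have "((\<lambda>R. integral {\<delta>..R} ?H) \<longlongrightarrow> integral {\<delta>..} ?H) at_top"
    using tendsto_set_lebesgue_integral_at_top[OF _ H] unfolding integral_eq by simp
  then show "((\<lambda>R. integral {t. \<delta> \<le> \<bar>t\<bar> \<and> \<bar>t\<bar> \<le> R} ?F) \<longlongrightarrow> tail_integral s \<delta> h) at_top"
    by (simp add: annulus tail_integral_def)
qed simp

lemma tail_integral_abs_le:
  assumes "borel_bounded C h"
  shows "\<bar>tail_integral s \<delta> h\<bar> \<le> C * \<delta> powr (- 2 * s) / s"
proof -
  note h = borel_bounded_reflect_add[OF assms]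
  have "norm (tail_integral s \<delta> h) \<le> integral {\<delta>..} (\<lambda>t. (2 * C) * t powr (- 1 - 2 * s))"
    unfolding tail_integral_def
  proof (rule integral_norm_bound_integral[OF integrable_tail[OF h]])
    show "(\<lambda>t. (2 * C) * t powr (- 1 - 2 * s)) integrable_on {\<delta>..}"
      using has_integral_tail_kernel by blast
    show "norm ((h t + h (- t)) * t powr (- 1 - 2 * s)) \<le> (2 * C) * t powr (- 1 - 2 * s)" for t
      using h by (simp add: abs_mult mult_right_mono borel_bounded_def)
  qed
  then show ?thesis
    using integral_unique[OF has_integral_tail_kernel[of "2 * C"]] by simp
qed

lemma tail_integral_add:
  assumes "borel_bounded C h" "borel_bounded D k"
  shows "tail_integral s \<delta> (\<lambda>t. h t + k t) = tail_integral s \<delta> h + tail_integral s \<delta> k"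
  unfolding tail_integral_def
  using assms[THEN borel_bounded_reflect_add, THEN integrable_tail]
  by (subst integral_add[symmetric]) (auto simp: algebra_simps)

end

lemma tail_integral_uminus: "tail_integral s \<delta> (\<lambda>t. - h t) = - tail_integral s \<delta> h"
proof -
  have "(\<lambda>t. (- h t + - h (- t)) * t powr (- 1 - 2 * s))
      = (\<lambda>t. - ((h t + h (- t)) * t powr (- 1 - 2 * s)))"
    by (auto simp: algebra_simps)
  then show ?thesis
    by (simp add: tail_integral_def)
qed

text \<open>The integral of \<open>H t * t powr (- 1 - 2 * s)\<close> over \<open>t > 0\<close>, where \<open>H\<close> is 0 before \<open>a\<close>, \<open>-m\<close> between
  \<open>a\<close> and \<open>b\<close>, and \<open>D\<close> beyond \<open>b\<close>.\<close>

definition step_tail :: "real \<Rightarrow> real \<Rightarrow> real \<Rightarrow> real \<Rightarrow> real \<Rightarrow> real" where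
  "step_tail s D m a b = ((D + m) * b powr (- 2 * s) - m * a powr (- 2 * s)) / (2 * s)"

lemma tail_integral_le:
  assumes s: "0 < s" and \<delta>: "0 < \<delta>" "\<delta> \<le> a" "a \<le> b" and h: "borel_bounded C h"
    and near: "\<And>t. \<delta> \<le> t \<Longrightarrow> t < a \<Longrightarrow> h t + h (- t) \<le> 0"
    and middle: "\<And>t. a \<le> t \<Longrightarrow> t < b \<Longrightarrow> h t + h (- t) \<le> - m"
  shows "tail_integral s \<delta> h \<le> step_tail s (2 * C) m a b"
proof -
  let ?ker = "\<lambda>t. t powr (- 1 - 2 * s)"
  let ?step = "\<lambda>c r t. if t \<in> {r..} then c * ?ker t else 0"
  have step: "(?step c r has_integral c * (r powr (- 2 * s) / (2 * s))) {\<delta>..}" if "\<delta> \<le> r" for c r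
    using has_integral_tail_kernel[OF s, of r c] \<delta> that by (subst has_integral_restrict) auto
  have "tail_integral s \<delta> h
      \<le> (2 * C + m) * (b powr (- 2 * s) / (2 * s)) + - m * (a powr (- 2 * s) / (2 * s))"
    unfolding tail_integral_def
  proof (rule has_integral_le[OF integrable_integral has_integral_add])
    show "(\<lambda>t. (h t + h (- t)) * ?ker t) integrable_on {\<delta>..}"
      by (rule integrable_tail[OF s \<delta>(1) borel_bounded_reflect_add[OF h]])
    show "(?step (2 * C + m) b has_integral (2 * C + m) * (b powr (- 2 * s) / (2 * s))) {\<delta>..}"
      "(?step (- m) a has_integral - m * (a powr (- 2 * s) / (2 * s))) {\<delta>..}"
      using \<delta> by (intro step; simp)+
    fix t assume "t \<in> {\<delta>..}"
    then consider "\<delta> \<le> t" "t < a" | "a \<le> t" "t < b" | "a \<le> t" "b \<le> t"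
      using \<delta> by fastforce
    then show "(h t + h (- t)) * ?ker t \<le> ?step (2 * C + m) b t + ?step (- m) a t"
    proof cases
      case 1
      then show ?thesis
        using near[of t] \<delta> by (auto simp: mult_nonpos_nonneg)
    next
      case 2
      then show ?thesis
        using mult_right_mono[OF middle[of t], of "?ker t"] by auto
    next
      case 3
      have "h t + h (- t) \<le> 2 * C"
        using borel_bounded_reflect_add[OF h] by (auto simp: borel_bounded_def abs_le_iff)
      then show ?thesis
        using mult_right_mono[of "h t + h (- t)" "2 * C" "?ker t"] 3 by (auto simp: algebra_simps)
    qed
  qed
  then show ?thesis
    by (simp add: step_tail_def diff_divide_distrib)
qed

definition line_tail :: "real \<Rightarrow> real \<Rightarrow> ('a::real_vector \<Rightarrow> real) \<Rightarrow> 'a \<Rightarrow> 'a \<Rightarrow> real" where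
  "line_tail s \<delta> w x z = tail_integral s \<delta> (\<lambda>t. w (x + t *\<^sub>R z) - w x)"

section \<open>Upper semicontinuous functions\<close>

definition upper_semicontinuous :: "('a::topological_space \<Rightarrow> real) \<Rightarrow> bool" where
  "upper_semicontinuous f \<longleftrightarrow> (\<forall>a. open {x. f x < a})"

lemma upper_semicontinuous_nhd:
  fixes f :: "'a::metric_space \<Rightarrow> real"
  assumes "upper_semicontinuous f" "f x < a"
  obtains e where "0 < e" "\<And>y. y \<in> ball x e \<Longrightarrow> f y < a"
proof -
  have "open {x. f x < a}" "x \<in> {x. f x < a}"
    using assms by (auto simp: upper_semicontinuous_def)
  then obtain e where "0 < e" "ball x e \<subseteq> {x. f x < a}"
    using open_contains_ball by blast
  then show ?thesis
    using that by blast
qed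

lemma continuous_imp_upper_semicontinuous:
  "continuous_on UNIV f \<Longrightarrow> upper_semicontinuous f"
  by (simp add: upper_semicontinuous_def open_Collect_less continuous_on_const)

lemma upper_semicontinuous_add:
  assumes "upper_semicontinuous f" "upper_semicontinuous g"
  shows "upper_semicontinuous (\<lambda>x. f x + g x)"
  unfolding upper_semicontinuous_def
proof
  fix a
  have "{x. f x + g x < a} = (\<Union>q. {x. f x < q} \<inter> {x. g x < a - q})"
  proof (intro equalityI subsetI)
    fix x assume "x \<in> {x. f x + g x < a}"
    then have "f x < a - g x" by auto
    then obtain q where "f x < q" "q < a - g x"
      using dense by blast
    then show "x \<in> (\<Union>q. {x. f x < q} \<inter> {x. g x < a - q})"
      by (auto intro!: exI[of _ q])
  qed auto
  also have "open \<dots>"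
    using assms unfolding upper_semicontinuous_def by (intro open_UN ballI open_Int) auto
  finally show "open {x. f x + g x < a}" .
qed

lemma upper_semicontinuous_compose:
  assumes "upper_semicontinuous f" "continuous_on UNIV h"
  shows "upper_semicontinuous (\<lambda>x. f (h x))"
  using assms open_vimage[of "{x. f x < a}" h for a]
  by (auto simp: upper_semicontinuous_def vimage_def)

lemma upper_semicontinuous_attains_sup:
  assumes "compact K" "K \<noteq> {}" "upper_semicontinuous f"
  obtains x where "x \<in> K" "\<And>y. y \<in> K \<Longrightarrow> f y \<le> f x"
proof (rule ccontr)
  assume "\<not> thesis"
  then have "K \<subseteq> (\<Union>y\<in>K. {x. f x < f y})"
    using that by (force simp: not_le)
  then obtain D where D: "D \<subseteq> K" "finite D" "K \<subseteq> (\<Union>y\<in>D. {x. f x < f y})"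
    using compactE_image[OF assms(1), of K "\<lambda>y. {x. f x < f y}"] assms(3)
    by (auto simp: upper_semicontinuous_def)
  then have "D \<noteq> {}"
    using assms(2) by auto
  then have "Max (f ` D) \<in> f ` D"
    using D(2) by simp
  then obtain x where x: "x \<in> D" "f x = Max (f ` D)"
    by auto
  then obtain y where "y \<in> D" "f x < f y"
    using D by blast
  moreover have "f y \<le> Max (f ` D)"
    using \<open>y \<in> D\<close> D(2) by simp
  ultimately show False
    using x(2) by linarith
qed

lemma upper_semicontinuous_borel_bounded:
  assumes "upper_semicontinuous f" "\<And>x. \<bar>f x\<bar> \<le> C"
  shows "borel_bounded C f"
  unfolding borel_bounded_def
proof
  show "f \<in> borel_measurable borel"
    using assms(1) by (intro borel_measurableI_less) (auto simp: upper_semicontinuous_def)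
qed (use assms(2) in blast)

context
  fixes u :: "'a::metric_space \<Rightarrow> real" and C :: real
  assumes bound: "\<And>x. \<bar>u x\<bar> \<le> C"
begin

lemma SUP_ball_bounds:
  assumes "0 < e"
  shows "u x \<le> (SUP y\<in>ball x e. u y)" "(SUP y\<in>ball x e. u y) \<le> C"
proof -
  have "bdd_above (u ` ball x e)"
    using bound by (intro bdd_aboveI2[of _ _ C]) (auto simp: abs_le_iff)
  then show "u x \<le> (SUP y\<in>ball x e. u y)"
    using assms by (intro cSUP_upper) auto
  show "(SUP y\<in>ball x e. u y) \<le> C"
    using assms bound by (intro cSUP_least) (auto simp: abs_le_iff)
qed

lemma usc_envelope_le_SUP:
  assumes "0 < e"
  shows "usc_envelope u x \<le> (SUP y\<in>ball x e. u y)"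
  unfolding usc_envelope_def
  using assms SUP_ball_bounds(1)[of _ x]
  by (intro cINF_lower bdd_belowI2[of _ "u x"]) auto

lemma usc_envelope_ge: "u x \<le> usc_envelope u x"
  unfolding usc_envelope_def
  by (rule cINF_greatest) (use SUP_ball_bounds(1) in \<open>auto intro: gt_ex\<close>)

lemma usc_envelope_abs_le: "\<bar>usc_envelope u x\<bar> \<le> C"
  using usc_envelope_ge[of x] usc_envelope_le_SUP[of 1 x] SUP_ball_bounds(2)[of 1 x] bound[of x]
  by (simp add: abs_le_iff)

lemma upper_semicontinuous_usc_envelope: "upper_semicontinuous (usc_envelope u)"
  unfolding upper_semicontinuous_def open_contains_ball
proof (intro allI ballI)
  fix a x assume "x \<in> {x. usc_envelope u x < a}"
  then obtain e where e: "0 < e" "(SUP y\<in>ball x e. u y) < a"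
    using cInf_lessD[of "(\<lambda>e. SUP y\<in>ball x e. u y) ` {0<..}" a] by (auto simp: usc_envelope_def)
  have "usc_envelope u y < a" if "y \<in> ball x e" for y
  proof -
    have pos: "0 < e - dist x y"
      using that by simp
    have "w \<in> ball x e" if "w \<in> ball y (e - dist x y)" for w
      using that dist_triangle[of x w y] by simp
    then have sub: "ball y (e - dist x y) \<subseteq> ball x e"
      by blast
    have "usc_envelope u y \<le> (SUP y\<in>ball y (e - dist x y). u y)"
      by (rule usc_envelope_le_SUP[OF pos])
    also have "\<dots> \<le> (SUP y\<in>ball x e. u y)"
      using pos sub bound by (intro cSUP_subset_mono bdd_aboveI2[of _ _ C]) (auto simp: abs_le_iff)
    finally show ?thesis
      using e(2) by simp
  qed
  then show "\<exists>e>0. ball x e \<subseteq> {x. usc_envelope u x < a}"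
    using e(1) by blast
qed

end

lemma lsc_envelope_eq: "lsc_envelope v x = - usc_envelope (\<lambda>x. - v x) x"
  by (simp add: lsc_envelope_def usc_envelope_def Inf_real_def image_image)

section \<open>Extensions by the exterior datum\<close>

lemma lower_ext_eq: "lower_ext \<Omega> g v x = - upper_ext \<Omega> (\<lambda>x. - g x) (\<lambda>x. - v x) x"
  by (auto simp: lower_ext_def upper_ext_def max_def min_def)

lemma upper_ext_eq: "x \<in> \<Omega> \<or> g x < upper_ext \<Omega> g u x \<Longrightarrow> upper_ext \<Omega> g u x = u x"
  by (auto simp: upper_ext_def max_def split: if_splits)

lemma upper_ext_ge_datum: "x \<notin> \<Omega> \<Longrightarrow> g x \<le> upper_ext \<Omega> g u x"
  by (auto simp: upper_ext_def)

lemma upper_ext_off_closure: "x \<notin> closure \<Omega> \<Longrightarrow> upper_ext \<Omega> g u x = g x"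
  using closure_subset[of \<Omega>] by (auto simp: upper_ext_def frontier_def)

lemma upper_ext_ge:
  assumes "\<And>x. x \<notin> closure \<Omega> \<Longrightarrow> u x \<le> g x"
  shows "u x \<le> upper_ext \<Omega> g u x"
  using assms[of x] interior_subset[of \<Omega>] by (auto simp: upper_ext_def frontier_def)

lemma upper_ext_abs_le:
  assumes "\<And>x. \<bar>u x\<bar> \<le> C" "\<And>x. x \<notin> \<Omega> \<Longrightarrow> \<bar>g x\<bar> \<le> C"
  shows "\<bar>upper_ext \<Omega> g u x\<bar> \<le> C"
  using assms by (auto simp: upper_ext_def max_def)

lemma upper_semicontinuous_upper_ext:
  fixes \<Omega> :: "'a::euclidean_space set"
  assumes "open \<Omega>" "upper_semicontinuous u" "continuous_on (- \<Omega>) g"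
    and off: "\<And>x. x \<notin> closure \<Omega> \<Longrightarrow> u x \<le> g x"
  shows "upper_semicontinuous (upper_ext \<Omega> g u)"
  unfolding upper_semicontinuous_def
proof
  fix a
  have "closed {x \<in> - \<Omega>. a \<le> g x}"
    using assms(1,3) continuous_on_closed_Collect_le[of "- \<Omega>" "\<lambda>_. a" g] by auto
  moreover have "{x. upper_ext \<Omega> g u x < a} = {x. u x < a} \<inter> - {x \<in> - \<Omega>. a \<le> g x}"
  proof (intro set_eqI)
    fix x
    show "x \<in> {x. upper_ext \<Omega> g u x < a} \<longleftrightarrow> x \<in> {x. u x < a} \<inter> - {x \<in> - \<Omega>. a \<le> g x}"
      using upper_ext_ge[of \<Omega> u g x, OF off] by (auto simp: upper_ext_def)
  qed
  ultimately show "open {x. upper_ext \<Omega> g u x < a}"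
    using assms(2) by (auto simp: upper_semicontinuous_def)
qed

section \<open>Paraboloids as test functions\<close>

definition paraboloid :: "'a::euclidean_space \<Rightarrow> 'a \<Rightarrow> real \<Rightarrow> 'a \<Rightarrow> real" where
  "paraboloid x p b y = p \<bullet> (y - x) + b * (norm (y - x))\<^sup>2"

definition paraboloid_above :: "('a::euclidean_space \<Rightarrow> real) \<Rightarrow> 'a \<Rightarrow> 'a \<Rightarrow> real \<Rightarrow> real \<Rightarrow> bool" where
  "paraboloid_above w x p b \<delta> \<longleftrightarrow> (\<forall>y\<in>ball x \<delta>. w y \<le> w x + paraboloid x p b y)"

text \<open>The principal value of a paraboloid over \<open>(-\<delta>, \<delta>)\<close> depends on \<open>b\<close> only: the linear part is odd.\<close>

definition paraboloid_operator ::
  "real \<Rightarrow> real \<Rightarrow> real \<Rightarrow> ('a::euclidean_space \<Rightarrow> real) \<Rightarrow> 'a \<Rightarrow> 'a \<Rightarrow> real" where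
  "paraboloid_operator s b \<delta> w x z =
     b * \<delta> powr (2 - 2 * s) / (1 - s) + line_tail s \<delta> w x z"

lemma paraboloid_vertex [simp]: "paraboloid x p b x = 0"
  by (simp add: paraboloid_def)

lemma paraboloid_uminus: "paraboloid x (- p) (- b) y = - paraboloid x p b y"
  by (simp add: paraboloid_def)

lemma paraboloid_along_line:
  "norm z = 1 \<Longrightarrow> paraboloid x p b (x + t *\<^sub>R z) = (p \<bullet> z) * t + b * t\<^sup>2"
  by (simp add: paraboloid_def)

lemma norm_square_eq_paraboloid:
  fixes a c y :: "'a::euclidean_space"
  shows "b * (norm (y - c))\<^sup>2 = b * (norm (a - c))\<^sup>2 + paraboloid a ((2 * b) *\<^sub>R (a - c)) b y"
  unfolding paraboloid_def power2_norm_eq_inner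
  by (simp add: inner_simps inner_commute algebra_simps)

lemma C2_on_paraboloid: "C2_on UNIV (paraboloid (x :: 'a::euclidean_space) p b)"
proof -
  let ?D = "\<lambda>y. blinfun_inner_right (p + (2 * b) *\<^sub>R (y - x))"
  let ?D2 = "\<lambda>y::'a. (2 * b) *\<^sub>R Blinfun (blinfun_inner_right :: 'a \<Rightarrow> 'a \<Rightarrow>\<^sub>L real)"
  have "(paraboloid x p b has_derivative blinfun_apply (?D y)) (at y)" for y
    unfolding paraboloid_def power2_norm_eq_inner
    by (auto intro!: derivative_eq_intros simp: fun_eq_iff inner_add_left inner_diff_left
        inner_commute algebra_simps)
  moreover have "(?D has_derivative blinfun_apply (?D2 y)) (at y)" for y
  proof -
    have "(?D has_derivative (\<lambda>h. blinfun_inner_right ((2 * b) *\<^sub>R h))) (at y)"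
      by (rule bounded_linear.has_derivative[OF bounded_linear_blinfun_inner_right])
         (auto intro!: derivative_eq_intros)
    moreover have "(\<lambda>h. blinfun_inner_right ((2 * b) *\<^sub>R h)) = blinfun_apply (?D2 y)"
      by (auto simp: fun_eq_iff blinfun.scaleR_left bounded_linear_Blinfun_apply
          bounded_linear_blinfun_inner_right linear_simps(5)[OF bounded_linear_blinfun_inner_right])
    ultimately show ?thesis
      by simp
  qed
  ultimately show ?thesis
    unfolding C2_on_def
    by (intro conjI exI[of _ ?D] exI[of _ ?D2]) auto
qed

lemma paraboloid_operator_uminus:
  "paraboloid_operator s (- b) \<delta> (\<lambda>y. - w y) x z = - paraboloid_operator s b \<delta> w x z"
  using tail_integral_uminus[of s \<delta> "\<lambda>t. w (x + t *\<^sub>R z) - w x"]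
  by (simp add: paraboloid_operator_def line_tail_def)

context
  fixes s \<delta> C :: real and u w :: "'a::euclidean_space \<Rightarrow> real" and x :: 'a
  assumes s: "0 < s" "s < 1" and \<delta>: "0 < \<delta>"
    and w: "borel_bounded C w" and w_eq: "w x = u x"
begin

lemma E_z_paraboloid:
  assumes "norm z = 1"
  shows "E_z s f u w (paraboloid x p b) \<delta> z x = paraboloid_operator s b \<delta> w x z - f x"
  unfolding E_z_def paraboloid_operator_def line_tail_def paraboloid_vertex diff_zero
    paraboloid_along_line[OF assms] principal_value_quadratic[OF s(2) \<delta>]
  using improper_integral_eq_tail_integral[OF s(1) \<delta> borel_bounded_increment[OF w], of x z]
  by (simp add: w_eq)

lemma E_delta_paraboloid_nonposD:
  assumes "E_delta s f u w (paraboloid x p b) \<delta> x \<le> 0" and z: "norm z = 1"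
  shows "f x \<le> paraboloid_operator s b \<delta> w x z"
proof -
  let ?E = "\<lambda>z. E_z s f u w (paraboloid x p b) \<delta> z x"
  have "bdd_below (?E ` sphere 0 1)"
  proof (rule bdd_belowI2)
    fix z :: 'a assume "z \<in> sphere 0 1"
    then show "b * \<delta> powr (2 - 2 * s) / (1 - s) - (2 * C) * \<delta> powr (- 2 * s) / s - f x \<le> ?E z"
      using tail_integral_abs_le[OF s(1) \<delta> borel_bounded_increment[OF w], of x z]
      by (simp add: E_z_paraboloid paraboloid_operator_def line_tail_def abs_le_iff)
  qed
  then have "(INF z\<in>sphere 0 1. ?E z) \<le> ?E z"
    using z by (intro cINF_lower) auto
  then show ?thesis
    using assms(1) unfolding E_delta_def E_z_paraboloid[OF z] by linarith
qed

lemma E_delta_paraboloid_nonnegD: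
  assumes "0 \<le> E_delta s f u w (paraboloid x p b) \<delta> x" "0 < e"
  obtains z where "norm z = 1" "paraboloid_operator s b \<delta> w x z < f x + e"
proof -
  let ?E = "\<lambda>z. E_z s f u w (paraboloid x p b) \<delta> z x"
  have "(INF z\<in>sphere 0 1. ?E z) < e"
    using assms unfolding E_delta_def by linarith
  then obtain z :: 'a where z: "norm z = 1" "?E z < e"
    using cInf_lessD[of "?E ` sphere 0 1" e] by auto
  then have "paraboloid_operator s b \<delta> w x z < f x + e"
    by (simp add: E_z_paraboloid)
  then show thesis
    using that z(1) by blast
qed

end

text \<open>Testing only where \<open>x \<in> \<Omega>\<close> or \<open>g x < w x\<close> ensures that an extension \<open>w\<close> by \<open>g\<close> coincides with
  the function it extends, and that the boundary alternative in the definition of a subsolution is void.\<close>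

definition subsolution_every_direction :: "real \<Rightarrow> 'a::euclidean_space set \<Rightarrow> ('a \<Rightarrow> real)
    \<Rightarrow> ('a \<Rightarrow> real) \<Rightarrow> ('a \<Rightarrow> real) \<Rightarrow> bool" where
  "subsolution_every_direction s \<Omega> f g w \<longleftrightarrow>
     (\<forall>x\<in>closure \<Omega>. \<forall>p b. \<forall>\<delta>>0. (x \<in> \<Omega> \<or> g x < w x) \<longrightarrow> paraboloid_above w x p b \<delta> \<longrightarrow>
       (\<forall>z. norm z = 1 \<longrightarrow> f x \<le> paraboloid_operator s b \<delta> w x z))"

definition subsolution_some_direction :: "real \<Rightarrow> 'a::euclidean_space set \<Rightarrow> ('a \<Rightarrow> real)
    \<Rightarrow> ('a \<Rightarrow> real) \<Rightarrow> ('a \<Rightarrow> real) \<Rightarrow> bool" where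
  "subsolution_some_direction s \<Omega> f g w \<longleftrightarrow>
     (\<forall>x\<in>closure \<Omega>. \<forall>p b. \<forall>\<delta>>0. (x \<in> \<Omega> \<or> g x < w x) \<longrightarrow> paraboloid_above w x p b \<delta> \<longrightarrow>
       (\<forall>e>0. \<exists>z. norm z = 1 \<and> f x - e < paraboloid_operator s b \<delta> w x z))"

lemma subsolution_every_imp_some_direction:
  fixes \<Omega> :: "'a::euclidean_space set"
  assumes "subsolution_every_direction s \<Omega> f g w"
  shows "subsolution_some_direction s \<Omega> f g w"
proof -
  obtain z :: 'a where z: "norm z = 1"
    using vector_choose_size[of 1] by auto
  show ?thesis
    unfolding subsolution_some_direction_def
  proof (intro ballI allI impI)
    fix x p b \<delta> and e :: real
    assume "x \<in> closure \<Omega>" "0 < \<delta>" "x \<in> \<Omega> \<or> g x < w x" "paraboloid_above w x p b \<delta>" "0 < e"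
    then have "f x \<le> paraboloid_operator s b \<delta> w x z"
      using assms z unfolding subsolution_every_direction_def by blast
    then show "\<exists>z. norm z = 1 \<and> f x - e < paraboloid_operator s b \<delta> w x z"
      using z \<open>0 < e\<close> by (intro exI[of _ z]) simp
  qed
qed

lemma visc_sub_usc_imp_every_direction:
  fixes \<Omega> :: "'a::euclidean_space set" and f g u :: "'a \<Rightarrow> real"
  defines "w \<equiv> upper_ext \<Omega> g u"
  assumes s: "0 < s" "s < 1" and w_bounded: "borel_bounded C w" and u: "visc_sub_usc s \<Omega> f g u"
  shows "subsolution_every_direction s \<Omega> f g w"
  unfolding subsolution_every_direction_def
proof (intro ballI allI impI)
  fix x p z :: 'a and b \<delta> :: real
  assume x: "x \<in> closure \<Omega>" "x \<in> \<Omega> \<or> g x < w x" and \<delta>: "0 < \<delta>"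
    and above: "paraboloid_above w x p b \<delta>" and z: "norm z = 1"
  let ?\<phi> = "paraboloid x p b"
  have wx: "w x = u x"
    using x(2) unfolding w_def by (rule upper_ext_eq)
  have le: "u y \<le> w y" for y
    using u upper_ext_ge[of \<Omega> u g y] by (auto simp: w_def visc_sub_usc_def)
  have "u y - ?\<phi> y \<le> u x - ?\<phi> x" if "y \<in> ball x \<delta>" for y
    using bspec[OF above[unfolded paraboloid_above_def] that] le[of y] wx by simp
  then have test: "x \<in> \<Omega> \<Longrightarrow> E_delta s f u w ?\<phi> \<delta> x \<le> 0"
    "x \<in> frontier \<Omega> \<Longrightarrow> min (E_delta s f u w ?\<phi> \<delta> x) (u x - g x) \<le> 0"
    using u \<delta> C2_on_paraboloid[of x p b] unfolding visc_sub_usc_def w_def[symmetric] by blast+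
  have "E_delta s f u w ?\<phi> \<delta> x \<le> 0"
  proof (cases "x \<in> \<Omega>")
    case False
    then have "x \<in> frontier \<Omega>"
      using x(1) interior_subset by (auto simp: frontier_def)
    then show ?thesis
      using test(2) x(2) False wx by (auto simp: min_def split: if_splits)
  qed (rule test(1))
  then show "f x \<le> paraboloid_operator s b \<delta> w x z"
    using E_delta_paraboloid_nonposD[where u = u and x = x, OF s \<delta> w_bounded wx] z by blast
qed

lemma visc_super_lsc_imp_some_direction:
  fixes \<Omega> :: "'a::euclidean_space set" and f g v :: "'a \<Rightarrow> real"
  defines "w \<equiv> upper_ext \<Omega> (\<lambda>x. - g x) (\<lambda>x. - v x)"
  assumes s: "0 < s" "s < 1" and w_bounded: "borel_bounded C w" and v: "visc_super_lsc s \<Omega> f g v"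
  shows "subsolution_some_direction s \<Omega> (\<lambda>x. - f x) (\<lambda>x. - g x) w"
  unfolding subsolution_some_direction_def
proof (intro ballI allI impI)
  fix x p :: 'a and b \<delta> e :: real
  assume x: "x \<in> closure \<Omega>" "x \<in> \<Omega> \<or> - g x < w x" and \<delta>: "0 < \<delta>"
    and above: "paraboloid_above w x p b \<delta>" and e: "0 < e"
  let ?\<phi> = "paraboloid x (- p) (- b)"
  have lower: "lower_ext \<Omega> g v = (\<lambda>x. - w x)"
    by (simp add: fun_eq_iff lower_ext_eq w_def)
  have wx: "- w x = v x"
    using x(2) upper_ext_eq[of x \<Omega> "\<lambda>x. - g x" "\<lambda>x. - v x"] by (simp add: w_def)
  have le: "- v y \<le> w y" for y
    using v upper_ext_ge[of \<Omega> "\<lambda>x. - v x" "\<lambda>x. - g x" y] by (auto simp: w_def visc_super_lsc_def)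
  have "v x - ?\<phi> x \<le> v y - ?\<phi> y" if "y \<in> ball x \<delta>" for y
    using bspec[OF above[unfolded paraboloid_above_def] that] le[of y] wx
    by (simp add: paraboloid_uminus)
  then have test: "x \<in> \<Omega> \<Longrightarrow> 0 \<le> E_delta s f v (\<lambda>x. - w x) ?\<phi> \<delta> x"
    "x \<in> frontier \<Omega> \<Longrightarrow> 0 \<le> max (E_delta s f v (\<lambda>x. - w x) ?\<phi> \<delta> x) (v x - g x)"
    using v \<delta> C2_on_paraboloid[of x "- p" "- b"] unfolding visc_super_lsc_def lower by blast+
  have "0 \<le> E_delta s f v (\<lambda>x. - w x) ?\<phi> \<delta> x"
  proof (cases "x \<in> \<Omega>")
    case False
    then have "x \<in> frontier \<Omega>"
      using x(1) interior_subset by (auto simp: frontier_def)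
    then show ?thesis
      using test(2) x(2) False wx by (auto simp: max_def split: if_splits)
  qed (rule test(1))
  then obtain z where "norm z = 1" "paraboloid_operator s (- b) \<delta> (\<lambda>x. - w x) x z < f x + e"
    using E_delta_paraboloid_nonnegD[where u = v and x = x,
        OF s \<delta> borel_bounded_uminus[OF w_bounded] wx _ e] by blast
  then show "\<exists>z. norm z = 1 \<and> - f x - e < paraboloid_operator s b \<delta> w x z"
    unfolding paraboloid_operator_uminus by (intro exI[of _ z]) simp
qed

section \<open>Strictly convex sets\<close>

lemma strictly_convex_midpoint:
  assumes "strictly_convex \<Omega>" "p \<in> closure \<Omega>" "q \<in> closure \<Omega>" "p \<noteq> q"
  shows "midpoint p q \<in> \<Omega>"
  using assms midpoint_in_open_segment[of p q] unfolding strictly_convex_def by blast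

text \<open>Otherwise \<open>x0\<close> would, in the limit, be the midpoint of a nondegenerate segment with ends in
  \<open>closure \<Omega>\<close>, and hence lie in \<open>\<Omega>\<close>.\<close>

lemma strictly_convex_short_chords:
  fixes \<Omega> :: "'a::euclidean_space set"
  assumes "bounded \<Omega>" "strictly_convex \<Omega>" "x0 \<notin> \<Omega>" "0 < l"
  obtains \<rho> where "0 < \<rho>"
    "\<And>p q. \<lbrakk>p \<in> closure \<Omega>; q \<in> closure \<Omega>; midpoint p q \<in> ball x0 \<rho>\<rbrakk> \<Longrightarrow> dist p q < l"
proof -
  let ?S = "(\<lambda>(p, q). midpoint p q) ` ((closure \<Omega> \<times> closure \<Omega>) \<inter> {(p, q). l \<le> dist p q})"
  have "closed {(p, q :: 'a). l \<le> dist p q}"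
    unfolding split_def by (intro closed_Collect_le continuous_intros)
  then have "compact ?S"
    using assms(1) unfolding split_def midpoint_def
    by (intro compact_continuous_image compact_Int_closed compact_Times continuous_intros)
       (auto simp: compact_closure)
  then have "open (- ?S)"
    by (simp add: compact_imp_closed open_Compl)
  moreover have "x0 \<notin> ?S"
  proof
    assume "x0 \<in> ?S"
    then obtain p q where pq: "p \<in> closure \<Omega>" "q \<in> closure \<Omega>" "l \<le> dist p q" "x0 = midpoint p q"
      by auto
    then have "p \<noteq> q"
      using assms(4) by auto
    then have "midpoint p q \<in> \<Omega>"
      using strictly_convex_midpoint[OF assms(2) pq(1,2)] by simp
    then show False
      using assms(3) pq(4) by simp
  qed
  ultimately obtain \<rho> where \<rho>: "0 < \<rho>" "ball x0 \<rho> \<subseteq> - ?S"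
    using open_contains_ball by blast
  show thesis
  proof (rule that[OF \<rho>(1)], rule ccontr)
    fix p q assume "p \<in> closure \<Omega>" "q \<in> closure \<Omega>" "midpoint p q \<in> ball x0 \<rho>" "\<not> dist p q < l"
    then have "midpoint p q \<in> ?S"
      by (intro image_eqI[where x = "(p, q)"]) auto
    then show False
      using \<open>midpoint p q \<in> ball x0 \<rho>\<close> \<rho>(2) by blast
  qed
qed

lemma strictly_convex_supporting_functional:
  fixes \<Omega> :: "'a::euclidean_space set"
  assumes "open \<Omega>" "strictly_convex \<Omega>" "x0 \<in> frontier \<Omega>"
  obtains a where "\<And>y. y \<in> closure \<Omega> \<Longrightarrow> y \<noteq> x0 \<Longrightarrow> a \<bullet> x0 < a \<bullet> y"
proof -
  have convex: "convex \<Omega>"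
    using assms(2) by (simp add: strictly_convex_def)
  have x0: "x0 \<in> closure \<Omega>" "x0 \<notin> rel_interior \<Omega>"
    using assms(1,3) by (auto simp: frontier_def interior_open rel_interior_open)
  obtain a where a: "\<And>y. y \<in> rel_interior \<Omega> \<Longrightarrow> a \<bullet> x0 < a \<bullet> y"
    using supporting_hyperplane_relative_frontier[OF convex x0] by metis
  show thesis
  proof (rule that)
    fix y assume "y \<in> closure \<Omega>" "y \<noteq> x0"
    then have "midpoint x0 y \<in> \<Omega>"
      using strictly_convex_midpoint[OF assms(2) x0(1)] by auto
    then have "a \<bullet> x0 < a \<bullet> midpoint x0 y"
      using a assms(1) by (simp add: rel_interior_open)
    then show "a \<bullet> x0 < a \<bullet> y"
      by (simp add: midpoint_def inner_simps)
  qed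
qed

lemma strictly_convex_steep_functional:
  fixes \<Omega> :: "'a::euclidean_space set"
  assumes "bounded \<Omega>" "open \<Omega>" "strictly_convex \<Omega>" "x0 \<in> frontier \<Omega>" "0 < \<rho>" "0 \<le> m"
  obtains p where "\<And>y. y \<in> closure \<Omega> \<Longrightarrow> p \<bullet> x0 \<le> p \<bullet> y"
    "\<And>y. y \<in> closure \<Omega> - ball x0 \<rho> \<Longrightarrow> p \<bullet> x0 + m \<le> p \<bullet> y"
proof -
  obtain a where a: "\<And>y. y \<in> closure \<Omega> \<Longrightarrow> y \<noteq> x0 \<Longrightarrow> a \<bullet> x0 < a \<bullet> y"
    using strictly_convex_supporting_functional[OF assms(2-4)] by blast
  then have a_le: "a \<bullet> x0 \<le> a \<bullet> y" if "y \<in> closure \<Omega>" for y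
    by (cases "y = x0") (auto intro: less_imp_le a that)
  let ?K = "closure \<Omega> - ball x0 \<rho>"
  show thesis
  proof (cases "?K = {}")
    case True
    then show thesis
      using that[of a] a_le by blast
  next
    case False
    have "compact ?K"
      using assms(1) by (intro compact_diff) (auto simp: compact_closure)
    moreover have "continuous_on ?K (\<lambda>y. a \<bullet> y)"
      by (intro continuous_intros)
    ultimately obtain y0 where y0: "y0 \<in> ?K" "\<And>y. y \<in> ?K \<Longrightarrow> a \<bullet> y0 \<le> a \<bullet> y"
      using continuous_attains_inf[of ?K "\<lambda>y. a \<bullet> y"] False by metis
    define c where "c = a \<bullet> y0 - a \<bullet> x0"
    have c: "0 < c"
      using a[of y0] y0(1) assms(5) by (cases "y0 = x0") (auto simp: c_def)
    show thesis
    proof (rule that[of "(m / c) *\<^sub>R a"])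
      show "((m / c) *\<^sub>R a) \<bullet> x0 \<le> ((m / c) *\<^sub>R a) \<bullet> y" if "y \<in> closure \<Omega>" for y
        using a_le[OF that] assms(6) c by (simp add: divide_right_mono mult_left_mono)
      show "((m / c) *\<^sub>R a) \<bullet> x0 + m \<le> ((m / c) *\<^sub>R a) \<bullet> y" if "y \<in> ?K" for y
      proof -
        have "(m / c) * c \<le> (m / c) * (a \<bullet> y - a \<bullet> x0)"
          using y0(2)[OF that] assms(6) c by (intro mult_left_mono) (auto simp: c_def)
        then show ?thesis
          using c by (simp add: right_diff_distrib)
      qed
    qed
  qed
qed

lemma affine_touching_near_frontier:
  fixes \<Omega> :: "'a::euclidean_space set"
  assumes "bounded \<Omega>" "open \<Omega>" "strictly_convex \<Omega>" "x0 \<in> frontier \<Omega>" "0 < \<rho>"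
    and w: "upper_semicontinuous w"
  obtains x p where "x \<in> closure \<Omega>" "x \<in> ball x0 \<rho>" "w x0 \<le> w x"
    "\<And>y. y \<in> closure \<Omega> \<Longrightarrow> w y \<le> w x + p \<bullet> (y - x)"
proof -
  have x0: "x0 \<in> closure \<Omega>"
    using assms(4) by (simp add: frontier_def)
  have K: "compact (closure \<Omega>)" "closure \<Omega> \<noteq> {}"
    using assms(1) x0 by (auto simp: compact_closure simp del: closure_eq_empty)
  obtain m where m: "\<And>y. y \<in> closure \<Omega> \<Longrightarrow> w y \<le> w m"
    using upper_semicontinuous_attains_sup[OF K w] by blast
  obtain p where p: "\<And>y. y \<in> closure \<Omega> \<Longrightarrow> p \<bullet> x0 \<le> p \<bullet> y"
    "\<And>y. y \<in> closure \<Omega> - ball x0 \<rho> \<Longrightarrow> p \<bullet> x0 + (w m - w x0 + 1) \<le> p \<bullet> y"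
    using strictly_convex_steep_functional[OF assms(1-5), of "w m - w x0 + 1"] m[OF x0] by auto
  have "upper_semicontinuous (\<lambda>y. w y + - (p \<bullet> y))"
    by (intro upper_semicontinuous_add w continuous_imp_upper_semicontinuous continuous_intros)
  then obtain x where x: "x \<in> closure \<Omega>" "\<And>y. y \<in> closure \<Omega> \<Longrightarrow> w y + - (p \<bullet> y) \<le> w x + - (p \<bullet> x)"
    using upper_semicontinuous_attains_sup[OF K] by blast
  show thesis
  proof (rule that[OF x(1)])
    show "x \<in> ball x0 \<rho>"
      using p(2)[of x] x(1) x(2)[OF x0] m[OF x(1)] by force
    show "w x0 \<le> w x"
      using x(2)[OF x0] p(1)[OF x(1)] by linarith
    show "w y \<le> w x + p \<bullet> (y - x)" if "y \<in> closure \<Omega>" for y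
      using x(2)[OF that] by (simp add: inner_diff_right)
  qed
qed

section \<open>Attainment of the exterior datum\<close>

lemma line_tail_le_of_short_chords:
  fixes w :: "'a::euclidean_space \<Rightarrow> real"
  assumes s: "0 < s" and \<delta>: "0 < \<delta>" "\<delta> \<le> \<tau>" "\<tau> \<le> r" and \<eta>: "0 \<le> \<eta>" and z: "norm z = 1"
    and w: "borel_bounded C w"
    and inside: "\<And>y. y \<in> ball x r \<inter> S \<Longrightarrow> w y \<le> w x + p \<bullet> (y - x)"
    and outside: "\<And>y. y \<in> ball x r - S \<Longrightarrow> w y \<le> w x - 2 * \<eta>"
    and top: "\<And>y. y \<in> ball x r \<Longrightarrow> w y \<le> w x + \<eta>"
    and chords: "\<And>t. \<tau> \<le> t \<Longrightarrow> \<not> (x + t *\<^sub>R z \<in> S \<and> x - t *\<^sub>R z \<in> S)"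
  shows "line_tail s \<delta> w x z \<le> step_tail s (4 * C) \<eta> \<tau> r"
proof -
  let ?h = "\<lambda>t. w (x + t *\<^sub>R z) - w x"
  have in_ball: "x + t *\<^sub>R z \<in> ball x r" "x - t *\<^sub>R z \<in> ball x r" if "\<delta> \<le> t" "t < r" for t
    using that \<delta>(1) z by (auto simp: dist_norm)
  have exits: "?h t + ?h (- t) \<le> - \<eta>"
    if "\<delta> \<le> t" "t < r" "\<not> (x + t *\<^sub>R z \<in> S \<and> x - t *\<^sub>R z \<in> S)" for t
    using in_ball[OF that(1,2)] that(3) outside[of "x + t *\<^sub>R z"] outside[of "x - t *\<^sub>R z"]
      top[of "x + t *\<^sub>R z"] top[of "x - t *\<^sub>R z"] by auto
  have "tail_integral s \<delta> ?h \<le> step_tail s (2 * (2 * C)) \<eta> \<tau> r"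
  proof (rule tail_integral_le[OF s \<delta> borel_bounded_increment[OF w]])
    fix t assume t: "\<delta> \<le> t" "t < \<tau>"
    show "?h t + ?h (- t) \<le> 0"
    proof (cases "x + t *\<^sub>R z \<in> S \<and> x - t *\<^sub>R z \<in> S")
      case True
      then show ?thesis
        using in_ball[of t] t \<delta>(3) inside[of "x + t *\<^sub>R z"] inside[of "x - t *\<^sub>R z"] by auto
    next
      case False
      then show ?thesis
        using exits[of t] t \<delta>(3) \<eta> by linarith
    qed
  next
    show "?h t + ?h (- t) \<le> - \<eta>" if "\<tau> \<le> t" "t < r" for t
      using exits[of t] chords[of t] that \<delta>(2) by auto
  qed
  then show ?thesis
    by (simp add: line_tail_def)
qed

lemma affine_above_on_small_ball:
  fixes w :: "'a::euclidean_space \<Rightarrow> real"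
  assumes "0 < \<tau>" "\<tau> \<le> r" "0 < m"
    and inside: "\<And>y. y \<in> ball x r \<inter> S \<Longrightarrow> w y \<le> w x + p \<bullet> (y - x)"
    and outside: "\<And>y. y \<in> ball x r - S \<Longrightarrow> w y \<le> w x - m"
  obtains \<delta> where "0 < \<delta>" "\<delta> \<le> \<tau>" "paraboloid_above w x p 0 \<delta>"
proof -
  define \<delta> where "\<delta> = min \<tau> (m / (norm p + 1))"
  have norm_p: "0 < norm p + 1"
    by (simp add: add_nonneg_pos)
  then have \<delta>: "0 < \<delta>" "\<delta> \<le> \<tau>"
    using assms(1,3) by (simp_all add: \<delta>_def)
  have "\<delta> * (norm p + 1) \<le> m"
    using norm_p by (simp add: \<delta>_def flip: pos_le_divide_eq)
  then have slope: "norm p * \<delta> \<le> m"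
    using \<delta>(1) by (simp add: algebra_simps)
  have "w y \<le> w x + p \<bullet> (y - x)" if y: "y \<in> ball x \<delta>" for y
  proof (cases "y \<in> S")
    case True
    then show ?thesis
      using inside[of y] y \<delta>(2) assms(2) by simp
  next
    case False
    have "- (p \<bullet> (y - x)) \<le> norm p * norm (y - x)"
      using Cauchy_Schwarz_ineq2[of p "y - x"] by linarith
    also have "\<dots> \<le> norm p * \<delta>"
      using y by (intro mult_left_mono) (auto simp: dist_norm norm_minus_commute)
    finally show ?thesis
      using outside[of y] y False \<delta>(2) assms(2) slope by simp
  qed
  then show thesis
    using that[OF \<delta>] by (simp add: paraboloid_above_def paraboloid_def)
qed

lemma step_tail_unbounded_below:
  fixes s r B D m :: real
  assumes "0 < s" "0 < m" "0 < r"
  obtains \<tau> where "0 < \<tau>" "\<tau> \<le> r" "step_tail s D m \<tau> r \<le> B"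
proof -
  have "filterlim (\<lambda>\<tau>. step_tail s D m \<tau> r) at_bot (at_right 0)"
    using assms(1,2) unfolding step_tail_def by real_asymp
  then have "\<forall>\<^sub>F \<tau> in at_right 0. step_tail s D m \<tau> r \<le> B"
    by (simp add: filterlim_at_bot)
  then have "\<forall>\<^sub>F \<tau> in at_right 0. step_tail s D m \<tau> r \<le> B \<and> \<tau> \<in> {0<..<r}"
    using eventually_at_right_real[OF assms(3)] by (rule eventually_conj)
  then obtain \<tau> where "step_tail s D m \<tau> r \<le> B" "\<tau> \<in> {0<..<r}"
    using eventually_happens'[OF trivial_limit_at_right_real] by blast
  then show thesis
    using that[of \<tau>] by simp
qed

locale dirichlet_extension =
  fixes s :: real and \<Omega> :: "'a::euclidean_space set" and g w :: "'a \<Rightarrow> real" and C :: real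
  assumes s: "0 < s" "s < 1"
    and \<Omega>: "bounded \<Omega>" "open \<Omega>" "strictly_convex \<Omega>"
    and g_continuous: "continuous_on (- \<Omega>) g"
    and w_usc: "upper_semicontinuous w" and w_abs_le: "\<bar>w x\<bar> \<le> C"
    and ge_datum: "x \<notin> \<Omega> \<Longrightarrow> g x \<le> w x" and le_datum: "x \<notin> closure \<Omega> \<Longrightarrow> w x \<le> g x"
begin

lemma w_bounded: "borel_bounded C w"
  by (rule upper_semicontinuous_borel_bounded[OF w_usc w_abs_le])

lemma boundary_gap_ball:
  assumes "x0 \<notin> \<Omega>" "g x0 < w x0"
  obtains \<eta> r where "0 < \<eta>" "0 < r" "\<And>y. y \<in> ball x0 r \<Longrightarrow> w y \<le> w x0 + \<eta>"
    "\<And>y. y \<in> ball x0 r - \<Omega> \<Longrightarrow> g y \<le> w x0 - 2 * \<eta>"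
proof -
  define \<eta> where "\<eta> = (w x0 - g x0) / 3"
  have \<eta>: "0 < \<eta>" "w x0 - 2 * \<eta> = g x0 + \<eta>"
    using assms(2) by (auto simp: \<eta>_def field_simps)
  obtain r1 where r1: "0 < r1" "\<And>y. y \<in> ball x0 r1 \<Longrightarrow> w y < w x0 + \<eta>"
    using upper_semicontinuous_nhd[OF w_usc, of x0 "w x0 + \<eta>"] \<eta>(1) by auto
  obtain r2 where r2: "0 < r2" "\<And>y. y \<in> - \<Omega> \<Longrightarrow> dist y x0 < r2 \<Longrightarrow> dist (g y) (g x0) < \<eta>"
    using g_continuous assms(1) \<eta>(1) unfolding continuous_on_iff by (metis ComplI)
  show thesis
  proof (rule that[of \<eta> "min r1 r2"])
    show "w y \<le> w x0 + \<eta>" if "y \<in> ball x0 (min r1 r2)" for y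
      using r1(2)[of y] that by simp
    show "g y \<le> w x0 - 2 * \<eta>" if "y \<in> ball x0 (min r1 r2) - \<Omega>" for y
      using r2(2)[of y] that \<eta>(2) by (auto simp: dist_real_def dist_commute)
  qed (use \<eta> r1 r2 in auto)
qed

lemma touching_point_near_gap:
  assumes x0: "x0 \<in> frontier \<Omega>" "g x0 < w x0"
  obtains x p \<eta> \<tau> r where "0 < \<eta>" "0 < \<tau>" "\<tau> \<le> r" "step_tail s (4 * C) \<eta> \<tau> r \<le> B"
    "x \<in> closure \<Omega>" "x \<in> \<Omega> \<or> g x < w x"
    "\<And>y. y \<in> ball x r \<inter> closure \<Omega> \<Longrightarrow> w y \<le> w x + p \<bullet> (y - x)"
    "\<And>y. y \<in> ball x r - closure \<Omega> \<Longrightarrow> w y \<le> w x - 2 * \<eta>"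
    "\<And>y. y \<in> ball x r \<Longrightarrow> w y \<le> w x + \<eta>"
    "\<And>z t. \<lbrakk>norm z = 1; \<tau> \<le> t\<rbrakk> \<Longrightarrow> \<not> (x + t *\<^sub>R z \<in> closure \<Omega> \<and> x - t *\<^sub>R z \<in> closure \<Omega>)"
proof -
  have x0_notin: "x0 \<notin> \<Omega>"
    using x0(1) \<Omega>(2) by (simp add: frontier_def interior_open)
  obtain \<eta> R where \<eta>: "0 < \<eta>" and R: "0 < R"
    and top: "\<And>y. y \<in> ball x0 R \<Longrightarrow> w y \<le> w x0 + \<eta>"
    and gap: "\<And>y. y \<in> ball x0 R - \<Omega> \<Longrightarrow> g y \<le> w x0 - 2 * \<eta>"
    using boundary_gap_ball[OF x0_notin x0(2)] by blast
  define r where "r = R / 2"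
  obtain \<tau> where \<tau>: "0 < \<tau>" "\<tau> \<le> r" "step_tail s (4 * C) \<eta> \<tau> r \<le> B"
    using step_tail_unbounded_below[OF s(1) \<eta>, of r] R by (auto simp: r_def)
  obtain \<rho> where \<rho>: "0 < \<rho>"
    "\<And>p q. \<lbrakk>p \<in> closure \<Omega>; q \<in> closure \<Omega>; midpoint p q \<in> ball x0 \<rho>\<rbrakk> \<Longrightarrow> dist p q < 2 * \<tau>"
    using strictly_convex_short_chords[OF \<Omega>(1,3) x0_notin, of "2 * \<tau>"] \<tau>(1) by auto
  obtain x p where x: "x \<in> closure \<Omega>" "x \<in> ball x0 (min \<rho> r)" "w x0 \<le> w x"
    and max: "\<And>y. y \<in> closure \<Omega> \<Longrightarrow> w y \<le> w x + p \<bullet> (y - x)"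
    using affine_touching_near_frontier[OF \<Omega> x0(1) _ w_usc, of "min \<rho> r"] \<rho>(1) R by (auto simp: r_def)
  have near: "y \<in> ball x0 R" if "y \<in> ball x r" for y
    using that x(2) dist_triangle[of x0 y x] by (simp add: r_def)
  show thesis
  proof (rule that[OF \<eta> \<tau> x(1)])
    show "x \<in> \<Omega> \<or> g x < w x"
      using gap[of x] near[of x] x(3) \<eta> \<tau>(1,2) by force
    show "w y \<le> w x + p \<bullet> (y - x)" if "y \<in> ball x r \<inter> closure \<Omega>" for y
      using that max by blast
    show "w y \<le> w x - 2 * \<eta>" if "y \<in> ball x r - closure \<Omega>" for y
      using that le_datum[of y] gap[of y] near[of y] x(3) closure_subset[of \<Omega>] by force
    show "w y \<le> w x + \<eta>" if "y \<in> ball x r" for y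
      using top[OF near[OF that]] x(3) by linarith
    show "\<not> (x + t *\<^sub>R z \<in> closure \<Omega> \<and> x - t *\<^sub>R z \<in> closure \<Omega>)" if "norm z = 1" "\<tau> \<le> t" for z t
    proof -
      have "midpoint (x + t *\<^sub>R z) (x - t *\<^sub>R z) = x"
        by (simp add: midpoint_eq_iff)
      moreover have "dist (x + t *\<^sub>R z) (x - t *\<^sub>R z) = 2 * t"
        using that \<tau>(1) by (simp add: dist_norm flip: scaleR_add_left)
      ultimately show ?thesis
        using \<rho>(2)[of "x + t *\<^sub>R z" "x - t *\<^sub>R z"] x(2) that(2) by auto
    qed
  qed
qed

lemma boundary_barrier:
  assumes x0: "x0 \<in> frontier \<Omega>" "g x0 < w x0"
  obtains x p \<delta> where "0 < \<delta>" "x \<in> closure \<Omega>" "x \<in> \<Omega> \<or> g x < w x" "paraboloid_above w x p 0 \<delta>"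
    "\<And>z. norm z = 1 \<Longrightarrow> line_tail s \<delta> w x z \<le> B"
proof -
  obtain x p \<eta> \<tau> r where \<eta>: "0 < \<eta>" and \<tau>: "0 < \<tau>" "\<tau> \<le> r"
    and bound: "step_tail s (4 * C) \<eta> \<tau> r \<le> B"
    and x: "x \<in> closure \<Omega>" "x \<in> \<Omega> \<or> g x < w x"
    and inside: "\<And>y. y \<in> ball x r \<inter> closure \<Omega> \<Longrightarrow> w y \<le> w x + p \<bullet> (y - x)"
    and outside: "\<And>y. y \<in> ball x r - closure \<Omega> \<Longrightarrow> w y \<le> w x - 2 * \<eta>"
    and top: "\<And>y. y \<in> ball x r \<Longrightarrow> w y \<le> w x + \<eta>"
    and chords: "\<And>z t. \<lbrakk>norm z = 1; \<tau> \<le> t\<rbrakk>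
      \<Longrightarrow> \<not> (x + t *\<^sub>R z \<in> closure \<Omega> \<and> x - t *\<^sub>R z \<in> closure \<Omega>)"
    by (rule touching_point_near_gap[OF x0]) blast
  obtain \<delta> where \<delta>: "0 < \<delta>" "\<delta> \<le> \<tau>" "paraboloid_above w x p 0 \<delta>"
    using affine_above_on_small_ball[of \<tau> r "2 * \<eta>" x "closure \<Omega>" w p] \<tau> \<eta> inside outside by auto
  show thesis
  proof (rule that[OF \<delta>(1) x \<delta>(3)])
    fix z :: 'a assume z: "norm z = 1"
    have "line_tail s \<delta> w x z \<le> step_tail s (4 * C) \<eta> \<tau> r"
      by (rule line_tail_le_of_short_chords[OF s(1) \<delta>(1,2) \<tau>(2) less_imp_le[OF \<eta>] z w_bounded
            inside outside top chords[OF z]])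
    then show "line_tail s \<delta> w x z \<le> B"
      using bound by (rule order_trans)
  qed
qed

lemma subsolution_eq_datum:
  assumes sub: "subsolution_some_direction s \<Omega> f g w"
    and f: "\<And>x. x \<in> closure \<Omega> \<Longrightarrow> F \<le> f x" and x0: "x0 \<notin> \<Omega>"
  shows "w x0 = g x0"
proof (rule ccontr)
  assume "w x0 \<noteq> g x0"
  then have "g x0 < w x0" "x0 \<in> frontier \<Omega>"
    using ge_datum[OF x0] le_datum[of x0] x0 interior_subset by (force simp: frontier_def)+
  then obtain x p \<delta> where \<delta>: "0 < \<delta>" and x: "x \<in> closure \<Omega>" "x \<in> \<Omega> \<or> g x < w x"
    and above: "paraboloid_above w x p 0 \<delta>"
    and barrier: "\<And>z. norm z = 1 \<Longrightarrow> line_tail s \<delta> w x z \<le> F - 1"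
    using boundary_barrier by metis
  then obtain z where "norm z = 1" "f x - 1 < paraboloid_operator s 0 \<delta> w x z"
    using sub unfolding subsolution_some_direction_def by (meson zero_less_one)
  then show False
    using barrier[of z] f[OF x(1)] by (simp add: paraboloid_operator_def)
qed

end

section \<open>Doubling of variables\<close>

definition penalized_maximum_on :: "'a::euclidean_space set \<Rightarrow> real \<Rightarrow> ('a \<Rightarrow> real) \<Rightarrow> ('a \<Rightarrow> real)
    \<Rightarrow> 'a \<Rightarrow> 'a \<Rightarrow> bool" where
  "penalized_maximum_on K n w v a b \<longleftrightarrow> (\<forall>x\<in>K. \<forall>y\<in>K.
     w x + v y - n * (norm (x - y))\<^sup>2 \<le> w a + v b - n * (norm (a - b))\<^sup>2)"

lemma penalized_maximum_onD:
  "\<lbrakk>penalized_maximum_on K n w v a b; x \<in> K; y \<in> K\<rbrakk>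
    \<Longrightarrow> w x + v y - n * (norm (x - y))\<^sup>2 \<le> w a + v b - n * (norm (a - b))\<^sup>2"
  by (simp add: penalized_maximum_on_def)

lemma doubling_maximum:
  fixes w v :: "'a::euclidean_space \<Rightarrow> real"
  assumes K: "compact K" "K \<noteq> {}" and w: "upper_semicontinuous w" and v: "upper_semicontinuous v"
    and d: "0 < d"
  obtains n a b where "0 < n" "a \<in> K" "b \<in> K" "dist a b < d" "penalized_maximum_on K n w v a b"
proof -
  obtain p where p: "p \<in> K" "\<And>y. y \<in> K \<Longrightarrow> w y \<le> w p"
    using upper_semicontinuous_attains_sup[OF K w] by blast
  obtain q where q: "\<And>y. y \<in> K \<Longrightarrow> v y \<le> v q"
    using upper_semicontinuous_attains_sup[OF K v] by blast
  define n where "n = (v q - v p + 1) / d\<^sup>2"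
  have n: "0 < n" "n * d\<^sup>2 = v q - v p + 1"
    using q[OF p(1)] d by (auto simp: n_def)
  let ?\<Phi> = "\<lambda>y. w (fst y) + v (snd y) + - n * (norm (fst y - snd y))\<^sup>2"
  have "upper_semicontinuous ?\<Phi>"
    by (intro upper_semicontinuous_add upper_semicontinuous_compose[OF w]
        upper_semicontinuous_compose[OF v] continuous_imp_upper_semicontinuous continuous_intros)
  then obtain m where m: "m \<in> K \<times> K" "\<And>y. y \<in> K \<times> K \<Longrightarrow> ?\<Phi> y \<le> ?\<Phi> m"
    using upper_semicontinuous_attains_sup[of "K \<times> K" ?\<Phi>] compact_Times[OF K(1) K(1)] K(2) by blast
  obtain a b where m_eq: "m = (a, b)" by (cases m)
  have ab: "a \<in> K" "b \<in> K"
    using m(1) by (auto simp: m_eq)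
  have max: "penalized_maximum_on K n w v a b"
    unfolding penalized_maximum_on_def
  proof (intro ballI)
    fix x y assume "x \<in> K" "y \<in> K"
    then show "w x + v y - n * (norm (x - y))\<^sup>2 \<le> w a + v b - n * (norm (a - b))\<^sup>2"
      using m(2)[of "(x, y)"] by (simp add: m_eq)
  qed
  have "dist a b < d"
  proof (rule ccontr)
    assume "\<not> dist a b < d"
    then have "d\<^sup>2 \<le> (norm (a - b))\<^sup>2"
      using d by (intro power_mono) (auto simp: dist_norm)
    then have "n * d\<^sup>2 \<le> n * (norm (a - b))\<^sup>2"
      using n(1) by simp
    then show False
      using penalized_maximum_onD[OF max p(1) p(1)] p(2)[OF ab(1)] q[OF ab(2)] n(2) by simp
  qed
  then show thesis
    using that[OF n(1) ab _ max] by blast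
qed

lemma near_diagonal_superlevel_in_open:
  fixes w v :: "'a::heine_borel \<Rightarrow> real"
  assumes "compact K" "open \<Omega>" "upper_semicontinuous w" "upper_semicontinuous v"
    and below: "\<And>x. x \<in> K - \<Omega> \<Longrightarrow> w x + v x < M"
  obtains d where "0 < d"
    "\<And>a b. \<lbrakk>a \<in> K; b \<in> K; dist a b < d; M \<le> w a + v b\<rbrakk> \<Longrightarrow> a \<in> \<Omega> \<and> b \<in> \<Omega>"
proof -
  let ?T = "(K \<times> K) \<inter> - {q. w (fst q) + v (snd q) < M} \<inter> - (\<Omega> \<times> \<Omega>)"
  let ?diagonal = "{q :: 'a \<times> 'a. fst q = snd q}"
  have "upper_semicontinuous (\<lambda>q. w (fst q) + v (snd q))"
    by (intro upper_semicontinuous_add upper_semicontinuous_compose[OF assms(3)]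
        upper_semicontinuous_compose[OF assms(4)] continuous_intros)
  then have "closed (- {q. w (fst q) + v (snd q) < M})" "closed (- (\<Omega> \<times> \<Omega>))"
    using assms(2) by (auto simp: upper_semicontinuous_def open_Times)
  then have "compact ?T"
    by (intro compact_Int_closed compact_Times assms(1))
  moreover have "closed ?diagonal"
    by (intro closed_Collect_eq continuous_intros)
  moreover have "?T \<inter> ?diagonal = {}"
    using below by (force simp: not_less)
  ultimately have "\<exists>d>0. \<forall>p\<in>?T. \<forall>q\<in>?diagonal. d \<le> dist p q"
    by (rule separate_compact_closed)
  then obtain d where d: "0 < d" "\<And>p q. p \<in> ?T \<Longrightarrow> q \<in> ?diagonal \<Longrightarrow> d \<le> dist p q"
    by blast
  show thesis
  proof (rule that[OF d(1)], rule ccontr)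
    fix a b assume "a \<in> K" "b \<in> K" "dist a b < d" "M \<le> w a + v b" "\<not> (a \<in> \<Omega> \<and> b \<in> \<Omega>)"
    then have "d \<le> dist (a, b) (b, b)"
      by (intro d(2)) auto
    then show False
      using \<open>dist a b < d\<close> by (simp add: dist_Pair_Pair)
  qed
qed

lemma doubling_interior_maximum:
  fixes w v :: "'a::euclidean_space \<Rightarrow> real"
  assumes K: "compact K" "x \<in> K" and \<Omega>: "open \<Omega>"
    and w: "upper_semicontinuous w" and v: "upper_semicontinuous v"
    and below: "\<And>y. y \<in> K - \<Omega> \<Longrightarrow> w y + v y < w x + v x" and d: "0 < d"
  obtains n a b where "a \<in> \<Omega>" "b \<in> \<Omega>" "dist a b < d" "w x + v x \<le> w a + v b"
    "penalized_maximum_on K n w v a b"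
proof -
  obtain d' where d': "0 < d'"
    "\<And>a b. \<lbrakk>a \<in> K; b \<in> K; dist a b < d'; w x + v x \<le> w a + v b\<rbrakk> \<Longrightarrow> a \<in> \<Omega> \<and> b \<in> \<Omega>"
    using near_diagonal_superlevel_in_open[OF K(1) \<Omega> w v below] by blast
  obtain n a b where n: "0 < n" and ab: "a \<in> K" "b \<in> K" "dist a b < min d d'"
    and max: "penalized_maximum_on K n w v a b"
    using doubling_maximum[OF K(1) _ w v, of "min d d'"] K(2) d d'(1) by auto
  have "0 \<le> n * (norm (a - b))\<^sup>2"
    using n by simp
  then have gap: "w x + v x \<le> w a + v b"
    using penalized_maximum_onD[OF max K(2) K(2)] by simp
  then have "a \<in> \<Omega>" "b \<in> \<Omega>"
    using d'(2)[OF ab(1,2)] ab(3) by auto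
  then show thesis
    using that[OF _ _ _ gap max] ab(3) by simp
qed

lemma penalized_maximum_on_commute:
  "penalized_maximum_on K n w v a b \<Longrightarrow> penalized_maximum_on K n v w b a"
  unfolding penalized_maximum_on_def by (metis add.commute norm_minus_commute)

lemma penalized_maximum_on_subset:
  "\<lbrakk>penalized_maximum_on K n w v a b; S \<subseteq> K\<rbrakk> \<Longrightarrow> penalized_maximum_on S n w v a b"
  by (auto simp: penalized_maximum_on_def)

lemma penalized_maximum_imp_paraboloid_above:
  assumes "penalized_maximum_on K n w v a b" "b \<in> K" "ball a \<delta> \<subseteq> K"
  shows "paraboloid_above w a ((2 * n) *\<^sub>R (a - b)) n \<delta>"
  unfolding paraboloid_above_def
proof
  fix y assume "y \<in> ball a \<delta>"
  then have "w y - n * (norm (y - b))\<^sup>2 \<le> w a - n * (norm (a - b))\<^sup>2"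
    using penalized_maximum_onD[OF assms(1) _ assms(2), of y] assms(3) by auto
  then show "w y \<le> w a + paraboloid a ((2 * n) *\<^sub>R (a - b)) n y"
    using norm_square_eq_paraboloid[of n y b a] by simp
qed

section \<open>Comparison\<close>

text \<open>The two extensions cancel outside \<open>\<Omega>\<close> up to the modulus of continuity of \<open>g\<close>, so the positive gap
  \<open>M\<close> makes the tails strictly negative; this replaces the usual perturbation to a strict subsolution.\<close>

lemma doubled_line_tails_le:
  fixes w v :: "'a::euclidean_space \<Rightarrow> real"
  assumes s: "0 < s" and \<delta>: "0 < \<delta>" "\<delta> \<le> 2 * r" "2 * r \<le> R" and z: "norm z = 1"
    and w: "borel_bounded C w" and v: "borel_bounded D v"
    and \<Omega>: "\<Omega> \<subseteq> ball 0 r" and ab: "a \<in> \<Omega>" "b \<in> \<Omega>" "M \<le> w a + v b"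
    and max: "penalized_maximum_on (cball 0 (3 * r)) n w v a b"
    and outside: "\<And>x y. \<lbrakk>x \<in> cball 0 (r + R) - \<Omega>; y \<in> cball 0 (r + R) - \<Omega>; dist x y = dist a b\<rbrakk>
      \<Longrightarrow> w x + v y \<le> M / 2"
  shows "line_tail s \<delta> w a z + line_tail s \<delta> v b z \<le> step_tail s (4 * (C + D)) M (2 * r) R"
proof -
  let ?h = "\<lambda>t. w (a + t *\<^sub>R z) - w a" and ?k = "\<lambda>t. v (b + t *\<^sub>R z) - v b"
  note bounded = borel_bounded_increment[OF w, of a z] borel_bounded_increment[OF v, of b z]
  have norm_less: "norm x < r" if "x \<in> \<Omega>" for x
    using that \<Omega> by auto
  have upper: "norm (a + t *\<^sub>R z) \<le> r + \<bar>t\<bar>" "norm (b + t *\<^sub>R z) \<le> r + \<bar>t\<bar>" for t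
    using norm_triangle_ineq[of a "t *\<^sub>R z"] norm_triangle_ineq[of b "t *\<^sub>R z"] z norm_less[OF ab(1)]
      norm_less[OF ab(2)] by auto
  have lower: "\<bar>t\<bar> - r < norm (a + t *\<^sub>R z)" "\<bar>t\<bar> - r < norm (b + t *\<^sub>R z)" for t
    using norm_diff_ineq[of "t *\<^sub>R z" a] norm_diff_ineq[of "t *\<^sub>R z" b] z norm_less[OF ab(1)]
      norm_less[OF ab(2)] by (auto simp: add.commute)
  have near: "?h t + ?k t \<le> 0" if "\<bar>t\<bar> \<le> 2 * r" for t
    using penalized_maximum_onD[OF max, of "a + t *\<^sub>R z" "b + t *\<^sub>R z"] upper[of t] that by simp
  have middle: "?h t + ?k t \<le> - (M / 2)" if "2 * r \<le> \<bar>t\<bar>" "\<bar>t\<bar> \<le> R" for t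
  proof -
    have "a + t *\<^sub>R z \<notin> \<Omega>" "b + t *\<^sub>R z \<notin> \<Omega>"
      using lower[of t] norm_less[of "a + t *\<^sub>R z"] norm_less[of "b + t *\<^sub>R z"] that(1) by auto
    then show ?thesis
      using outside[of "a + t *\<^sub>R z" "b + t *\<^sub>R z"] upper[of t] that(2) ab(3) by simp
  qed
  have "tail_integral s \<delta> (\<lambda>t. ?h t + ?k t) \<le> step_tail s (2 * (2 * C + 2 * D)) M (2 * r) R"
  proof (rule tail_integral_le[OF s \<delta> borel_bounded_add[OF bounded]])
    show "?h t + ?k t + (?h (- t) + ?k (- t)) \<le> 0" if "\<delta> \<le> t" "t < 2 * r" for t
      using near[of t] near[of "- t"] that \<delta>(1) by auto
    show "?h t + ?k t + (?h (- t) + ?k (- t)) \<le> - M" if "2 * r \<le> t" "t < R" for t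
      using middle[of t] middle[of "- t"] that \<delta> by auto
  qed
  then show ?thesis
    by (simp add: line_tail_def tail_integral_add[OF s \<delta>(1) bounded] distrib_left)
qed

lemma step_tail_eventually_negative:
  fixes s r D m :: real
  assumes "0 < s" "0 < m" "0 < r"
  obtains R where "r \<le> R" "step_tail s D m r R < 0"
proof -
  have "((\<lambda>R::real. R powr (- 2 * s)) \<longlongrightarrow> 0) at_top"
    using assms(1) by real_asymp
  then have "((\<lambda>R. step_tail s D m r R) \<longlongrightarrow> ((D + m) * 0 - m * r powr (- 2 * s)) / (2 * s)) at_top"
    unfolding step_tail_def using assms(1) by (intro tendsto_intros) auto
  then have "\<forall>\<^sub>F R in at_top. step_tail s D m r R < 0"
    using assms by (intro order_tendstoD(2)) (auto simp: divide_neg_pos)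
  then have "\<forall>\<^sub>F R in at_top. step_tail s D m r R < 0 \<and> r \<le> R"
    using eventually_ge_at_top by (rule eventually_conj)
  then show thesis
    using eventually_happens'[OF trivial_limit_at_top_linorder] that by blast
qed

lemma quadratic_part_arbitrarily_small:
  fixes s n c r :: real
  assumes "s < 1" "0 < c" "0 < r"
  obtains \<delta> where "0 < \<delta>" "\<delta> < r" "n * \<delta> powr (2 - 2 * s) / (1 - s) < c"
proof -
  have "((\<lambda>\<delta>::real. n * \<delta> powr (2 - 2 * s) / (1 - s)) \<longlongrightarrow> 0) (at_right 0)"
    using assms(1) by real_asymp
  then have "\<forall>\<^sub>F \<delta> in at_right 0. n * \<delta> powr (2 - 2 * s) / (1 - s) < c"
    using assms(2) by (rule order_tendstoD(2))
  then have "\<forall>\<^sub>F \<delta> in at_right 0. n * \<delta> powr (2 - 2 * s) / (1 - s) < c \<and> \<delta> \<in> {0<..<r}"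
    using eventually_at_right_real[OF assms(3)] by (rule eventually_conj)
  then obtain \<delta> where "n * \<delta> powr (2 - 2 * s) / (1 - s) < c" "\<delta> \<in> {0<..<r}"
    using eventually_happens'[OF trivial_limit_at_right_real] by blast
  then show thesis
    using that[of \<delta>] by simp
qed

lemma doubled_line_tails_greater:
  fixes \<Omega> :: "'a::euclidean_space set" and w v f g :: "'a \<Rightarrow> real"
  assumes s: "s < 1" and \<Omega>: "open \<Omega>" and ab: "a \<in> \<Omega>" "b \<in> \<Omega>" and pos: "0 < c" "0 < r"
    and w: "subsolution_every_direction s \<Omega> f g w"
    and v: "subsolution_some_direction s \<Omega> (\<lambda>x. - f x) g' v"
    and max: "penalized_maximum_on \<Omega> n w v a b"
  obtains \<delta> z where "0 < \<delta>" "\<delta> < r" "norm z = 1"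
    "f a - f b - c < line_tail s \<delta> w a z + line_tail s \<delta> v b z"
proof -
  obtain e e' where e: "0 < e" "ball a e \<subseteq> \<Omega>" "0 < e'" "ball b e' \<subseteq> \<Omega>"
    using ab \<Omega> by (meson open_contains_ball)
  obtain \<delta> where \<delta>: "0 < \<delta>" "\<delta> < min r (min e e')" "n * \<delta> powr (2 - 2 * s) / (1 - s) < c / 4"
    using quadratic_part_arbitrarily_small[OF s, of "c / 4" "min r (min e e')" n] pos e by auto
  then have balls: "ball a \<delta> \<subseteq> \<Omega>" "ball b \<delta> \<subseteq> \<Omega>"
    using e subset_ball[of \<delta> e a] subset_ball[of \<delta> e' b] by auto
  have "paraboloid_above v b ((2 * n) *\<^sub>R (b - a)) n \<delta>"
    by (rule penalized_maximum_imp_paraboloid_above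
        [OF penalized_maximum_on_commute[OF max] ab(1) balls(2)])
  moreover have "0 < c / 2" "b \<in> closure \<Omega>" "a \<in> closure \<Omega>"
    using pos(1) ab closure_subset by auto
  ultimately obtain z where z: "norm z = 1" "- f b - c / 2 < paraboloid_operator s n \<delta> v b z"
    using v \<delta>(1) ab(2) unfolding subsolution_some_direction_def by blast
  have "paraboloid_above w a ((2 * n) *\<^sub>R (a - b)) n \<delta>"
    by (rule penalized_maximum_imp_paraboloid_above[OF max ab(2) balls(1)])
  then have "f a \<le> paraboloid_operator s n \<delta> w a z"
    using w \<delta>(1) z(1) ab(1) \<open>a \<in> closure \<Omega>\<close> unfolding subsolution_every_direction_def by blast
  then have "f a - f b - c < line_tail s \<delta> w a z + line_tail s \<delta> v b z"
    using z(2) \<delta>(3) unfolding paraboloid_operator_def by argo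
  moreover have "\<delta> < r"
    using \<delta>(2) by simp
  ultimately show thesis
    using that[OF \<delta>(1) _ z(1)] by blast
qed

lemma compact_modulus_of_continuity:
  fixes f :: "'a::metric_space \<Rightarrow> real"
  assumes "compact K" "continuous_on K f" "0 < e"
  obtains d where "0 < d" "\<And>x y. \<lbrakk>x \<in> K; y \<in> K; dist x y < d\<rbrakk> \<Longrightarrow> \<bar>f x - f y\<bar> < e"
  using compact_uniformly_continuous[OF assms(2,1)] assms(3)
  unfolding uniformly_continuous_on_def dist_real_def by metis

lemma opposite_data_nearly_cancel:
  fixes w v g :: "'a::metric_space \<Rightarrow> real"
  assumes \<Omega>: "open \<Omega>" and g: "continuous_on (- \<Omega>) g" and K: "compact K" and e: "0 < e"
    and w: "\<And>x. x \<notin> \<Omega> \<Longrightarrow> w x = g x" and v: "\<And>x. x \<notin> \<Omega> \<Longrightarrow> v x = - g x"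
  obtains d where "0 < d" "\<And>x y. \<lbrakk>x \<in> K - \<Omega>; y \<in> K - \<Omega>; dist x y < d\<rbrakk> \<Longrightarrow> w x + v y < e"
proof -
  have "compact (K - \<Omega>)" "continuous_on (K - \<Omega>) g"
    using \<Omega> K continuous_on_subset[OF g] by (auto intro: compact_diff)
  then obtain d where d: "0 < d" "\<And>x y. \<lbrakk>x \<in> K - \<Omega>; y \<in> K - \<Omega>; dist x y < d\<rbrakk> \<Longrightarrow> \<bar>g x - g y\<bar> < e"
    using compact_modulus_of_continuity[OF _ _ e] by blast
  show thesis
  proof (rule that[OF d(1)])
    show "w x + v y < e" if "x \<in> K - \<Omega>" "y \<in> K - \<Omega>" "dist x y < d" for x y
      using d(2)[OF that] w[of x] v[of y] that(1,2) by (simp add: abs_less_iff)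
  qed
qed

lemma doubled_line_tails_uniformly_negative:
  fixes \<Omega> :: "'a::euclidean_space set" and w v g :: "'a \<Rightarrow> real"
  assumes s: "0 < s" and \<Omega>: "bounded \<Omega>" "open \<Omega>" and g: "continuous_on (- \<Omega>) g" and M: "0 < M"
    and w: "borel_bounded C w" "\<And>x. x \<notin> \<Omega> \<Longrightarrow> w x = g x"
    and v: "borel_bounded D v" "\<And>x. x \<notin> \<Omega> \<Longrightarrow> v x = - g x"
  obtains K r c d where "compact K" "\<Omega> \<subseteq> K" "0 < r" "0 < c" "0 < d"
    "\<forall>n a b z \<delta>. penalized_maximum_on K n w v a b \<and> a \<in> \<Omega> \<and> b \<in> \<Omega> \<and> dist a b < d \<and> M \<le> w a + v b
      \<and> norm z = 1 \<and> 0 < \<delta> \<and> \<delta> < r \<longrightarrow> line_tail s \<delta> w a z + line_tail s \<delta> v b z \<le> - c"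
proof -
  obtain r where r: "0 < r" "\<Omega> \<subseteq> ball 0 r"
    using bounded_subset_ballD[OF \<Omega>(1)] by blast
  obtain R where R: "2 * r \<le> R" "step_tail s (4 * (C + D)) M (2 * r) R < 0"
    using step_tail_eventually_negative[OF s M, of "2 * r"] r(1) by auto
  obtain d where d: "0 < d" "\<And>x y. \<lbrakk>x \<in> cball 0 (r + R) - \<Omega>; y \<in> cball 0 (r + R) - \<Omega>; dist x y < d\<rbrakk>
      \<Longrightarrow> w x + v y < M / 2"
    using opposite_data_nearly_cancel[OF \<Omega>(2) g compact_cball half_gt_zero[OF M] w(2) v(2)] by blast
  have tails: "line_tail s \<delta> w a z + line_tail s \<delta> v b z \<le> step_tail s (4 * (C + D)) M (2 * r) R"
    if max: "penalized_maximum_on (cball 0 (3 * r)) n w v a b" and ab: "a \<in> \<Omega>" "b \<in> \<Omega>" "dist a b < d"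
      "M \<le> w a + v b" and z: "norm z = 1" and \<delta>: "0 < \<delta>" "\<delta> < 2 * r" for n a b z \<delta>
  proof (rule doubled_line_tails_le[OF s \<delta>(1) less_imp_le[OF \<delta>(2)] R(1) z w(1) v(1) r(2) ab(1,2,4) max])
    show "w x + v y \<le> M / 2" if "x \<in> cball 0 (r + R) - \<Omega>" "y \<in> cball 0 (r + R) - \<Omega>"
      "dist x y = dist a b" for x y
      using d(2)[of x y] that ab(3) by simp
  qed
  show thesis
  proof (rule that[of "cball 0 (3 * r)" "2 * r" "- step_tail s (4 * (C + D)) M (2 * r) R" d])
    show "\<Omega> \<subseteq> cball 0 (3 * r)"
      using r by (auto simp: subset_eq)
  qed (use r(1) R(2) d(1) tails in \<open>simp_all only: minus_minus, auto\<close>)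
qed

lemma interior_comparison:
  fixes \<Omega> :: "'a::euclidean_space set" and w v f g :: "'a \<Rightarrow> real"
  assumes s: "0 < s" "s < 1" and \<Omega>: "bounded \<Omega>" "open \<Omega>"
    and f: "continuous_on (closure \<Omega>) f" and g: "continuous_on (- \<Omega>) g"
    and w: "upper_semicontinuous w" "borel_bounded C w" "\<And>x. x \<notin> \<Omega> \<Longrightarrow> w x = g x"
    and v: "upper_semicontinuous v" "borel_bounded D v" "\<And>x. x \<notin> \<Omega> \<Longrightarrow> v x = - g x"
    and w_sub: "subsolution_every_direction s \<Omega> f g w"
    and v_sub: "subsolution_some_direction s \<Omega> (\<lambda>x. - f x) (\<lambda>x. - g x) v"
  shows "w x + v x \<le> 0"
proof (rule ccontr)
  define M where "M = w x + v x"
  assume "\<not> w x + v x \<le> 0"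
  then have M: "0 < M" and x: "x \<in> \<Omega>"
    using w(3)[of x] v(3)[of x] by (fastforce simp: M_def)+
  obtain K r c d where K: "compact K" "\<Omega> \<subseteq> K" and pos: "0 < r" "0 < c" "0 < d"
    and upper: "\<forall>n a b z \<delta>. penalized_maximum_on K n w v a b \<and> a \<in> \<Omega> \<and> b \<in> \<Omega> \<and> dist a b < d
      \<and> M \<le> w a + v b \<and> norm z = 1 \<and> 0 < \<delta> \<and> \<delta> < r
      \<longrightarrow> line_tail s \<delta> w a z + line_tail s \<delta> v b z \<le> - c"
    using doubled_line_tails_uniformly_negative[OF s(1) \<Omega> g M w(2,3) v(2,3)] by blast
  have "compact (closure \<Omega>)" "0 < c / 2"
    using \<Omega>(1) pos(2) by (simp_all add: compact_closure)
  then obtain d' where d': "0 < d'"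
    "\<And>a b. \<lbrakk>a \<in> closure \<Omega>; b \<in> closure \<Omega>; dist a b < d'\<rbrakk> \<Longrightarrow> \<bar>f a - f b\<bar> < c / 2"
    using compact_modulus_of_continuity[OF _ f] by blast
  have x_K: "x \<in> K" and min_pos: "0 < min d d'"
    using x K(2) pos(3) d'(1) by auto
  have below: "w y + v y < w x + v x" if "y \<in> K - \<Omega>" for y
    using that w(3)[of y] v(3)[of y] M by (simp add: M_def)
  obtain n a b where ab: "a \<in> \<Omega>" "b \<in> \<Omega>" "dist a b < min d d'" "M \<le> w a + v b"
    and max: "penalized_maximum_on K n w v a b"
    using doubling_interior_maximum[OF K(1) x_K \<Omega>(2) w(1) v(1) below min_pos] unfolding M_def by blast
  obtain \<delta> z where \<delta>: "0 < \<delta>" "\<delta> < r" and z: "norm z = 1"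
    and lower: "f a - f b - c / 2 < line_tail s \<delta> w a z + line_tail s \<delta> v b z"
    using doubled_line_tails_greater[OF s(2) \<Omega>(2) ab(1,2) \<open>0 < c / 2\<close> pos(1) w_sub v_sub
        penalized_maximum_on_subset[OF max K(2)]] by blast
  have "line_tail s \<delta> w a z + line_tail s \<delta> v b z \<le> - c"
    using upper max ab \<delta> z by simp
  moreover have "\<bar>f a - f b\<bar> < c / 2"
    using d'(2)[of a b] ab(1-3) closure_subset[of \<Omega>] by auto
  ultimately show False
    using lower by linarith
qed

lemma comparison:
  fixes \<Omega> :: "'a::euclidean_space set"
  assumes w: "dirichlet_extension s \<Omega> g w C" "subsolution_every_direction s \<Omega> f g w"
    and v: "dirichlet_extension s \<Omega> (\<lambda>x. - g x) v D"
      "subsolution_some_direction s \<Omega> (\<lambda>x. - f x) (\<lambda>x. - g x) v"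
    and f: "continuous_on (closure \<Omega>) f"
  shows "w x + v x \<le> 0"
proof -
  interpret w: dirichlet_extension s \<Omega> g w C by (rule w(1))
  interpret v: dirichlet_extension s \<Omega> "\<lambda>x. - g x" v D by (rule v(1))
  have "bounded (f ` closure \<Omega>)"
    using w.\<Omega>(1) by (intro compact_imp_bounded compact_continuous_image f) (simp add: compact_closure)
  then obtain F where F: "\<And>y. y \<in> closure \<Omega> \<Longrightarrow> \<bar>f y\<bar> \<le> F"
    by (auto simp: bounded_iff)
  have "w y = g y" if "y \<notin> \<Omega>" for y
    using w.subsolution_eq_datum[OF subsolution_every_imp_some_direction[OF w(2)] _ that, of "- F"] F
    by (force simp: abs_le_iff)
  moreover have "v y = - g y" if "y \<notin> \<Omega>" for y
    using v.subsolution_eq_datum[OF v(2) _ that, of "- F"] F by (force simp: abs_le_iff)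
  ultimately show ?thesis
    using interior_comparison[OF w.s w.\<Omega>(1,2) f w.g_continuous w.w_usc w.w_bounded _
        v.w_usc v.w_bounded _ w(2) v(2)] by blast
qed

lemma dirichlet_extension_upper_ext_envelope:
  fixes \<Omega> :: "'a::euclidean_space set"
  assumes "0 < s" "s < 1" "bounded \<Omega>" "open \<Omega>" "strictly_convex \<Omega>" "continuous_on (- \<Omega>) g"
    and u: "\<And>x. \<bar>u x\<bar> \<le> C" and g: "\<And>x. x \<notin> \<Omega> \<Longrightarrow> \<bar>g x\<bar> \<le> C"
    and off: "\<And>x. x \<notin> closure \<Omega> \<Longrightarrow> usc_envelope u x \<le> g x"
  shows "dirichlet_extension s \<Omega> g (upper_ext \<Omega> g (usc_envelope u)) C"
proof
  show "upper_semicontinuous (upper_ext \<Omega> g (usc_envelope u))"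
    by (intro upper_semicontinuous_upper_ext upper_semicontinuous_usc_envelope[OF u] assms)
  show "\<bar>upper_ext \<Omega> g (usc_envelope u) x\<bar> \<le> C" for x
    by (intro upper_ext_abs_le usc_envelope_abs_le[OF u] g)
qed (use assms in \<open>auto simp: upper_ext_ge_datum upper_ext_off_closure\<close>)

lemma visc_subsolution_extension:
  fixes \<Omega> :: "'a::euclidean_space set"
  assumes "0 < s" "s < 1" "bounded \<Omega>" "open \<Omega>" "strictly_convex \<Omega>"
    and "continuous_on (- \<Omega>) g" "bounded (g ` (- \<Omega>))" and u: "visc_subsolution s \<Omega> f g u"
  obtains w C where "dirichlet_extension s \<Omega> g w C" "subsolution_every_direction s \<Omega> f g w"
    "\<And>x. u x \<le> w x"
proof -
  have "bounded (range u \<union> g ` (- \<Omega>))"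
    using assms(7) u by (simp add: visc_subsolution_def)
  then obtain C where C: "\<And>x. \<bar>u x\<bar> \<le> C" "\<And>x. x \<notin> \<Omega> \<Longrightarrow> \<bar>g x\<bar> \<le> C"
    by (auto simp: bounded_iff)
  let ?w = "upper_ext \<Omega> g (usc_envelope u)"
  have sub: "visc_sub_usc s \<Omega> f g (usc_envelope u)"
    using u by (simp add: visc_subsolution_def)
  then have off: "usc_envelope u x \<le> g x" if "x \<notin> closure \<Omega>" for x
    using that by (simp add: visc_sub_usc_def)
  have ext: "dirichlet_extension s \<Omega> g ?w C"
    by (intro dirichlet_extension_upper_ext_envelope assms C off)
  show thesis
  proof (rule that[OF ext])
    show "subsolution_every_direction s \<Omega> f g ?w"
      by (rule visc_sub_usc_imp_every_direction
          [OF assms(1,2) dirichlet_extension.w_bounded[OF ext] sub])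
    show "u x \<le> ?w x" for x
      using usc_envelope_ge[of u C x, OF C(1)] upper_ext_ge[of \<Omega> "usc_envelope u" g x, OF off]
      by linarith
  qed
qed

lemma visc_supersolution_extension:
  fixes \<Omega> :: "'a::euclidean_space set"
  assumes "0 < s" "s < 1" "bounded \<Omega>" "open \<Omega>" "strictly_convex \<Omega>"
    and "continuous_on (- \<Omega>) g" "bounded (g ` (- \<Omega>))" and v: "visc_supersolution s \<Omega> f g v"
  obtains w C where "dirichlet_extension s \<Omega> (\<lambda>x. - g x) w C"
    "subsolution_some_direction s \<Omega> (\<lambda>x. - f x) (\<lambda>x. - g x) w" "\<And>x. - v x \<le> w x"
proof -
  have "bounded (range v \<union> g ` (- \<Omega>))"
    using assms(7) v by (simp add: visc_supersolution_def)
  then obtain C where C: "\<And>x. \<bar>- v x\<bar> \<le> C" "\<And>x. x \<notin> \<Omega> \<Longrightarrow> \<bar>- g x\<bar> \<le> C"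
    by (auto simp: bounded_iff)
  let ?V = "usc_envelope (\<lambda>x. - v x)"
  let ?w = "upper_ext \<Omega> (\<lambda>x. - g x) ?V"
  have super: "visc_super_lsc s \<Omega> f g (\<lambda>x. - ?V x)"
    using v by (simp add: visc_supersolution_def lsc_envelope_eq[abs_def])
  then have off: "?V x \<le> - g x" if "x \<notin> closure \<Omega>" for x
    using that unfolding visc_super_lsc_def by force
  have ext: "dirichlet_extension s \<Omega> (\<lambda>x. - g x) ?w C"
    by (intro dirichlet_extension_upper_ext_envelope continuous_on_minus assms C off)
  show thesis
  proof (rule that[OF ext])
    show "subsolution_some_direction s \<Omega> (\<lambda>x. - f x) (\<lambda>x. - g x) ?w"
      using visc_super_lsc_imp_some_direction[where v = "\<lambda>x. - ?V x", OF assms(1,2) _ super]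
        dirichlet_extension.w_bounded[OF ext] by simp
    show "- v x \<le> ?w x" for x
      using usc_envelope_ge[of "\<lambda>x. - v x" C x, OF C(1)] upper_ext_ge[of \<Omega> ?V "\<lambda>x. - g x" x, OF off]
      by linarith
  qed
qed

theorem theorem2p2:
  fixes s :: real and \<Omega> :: "'a::euclidean_space set"
    and f g u v :: "'a \<Rightarrow> real"
  assumes "0 < s" "s < 1"
    and "bounded \<Omega>" "C2_domain \<Omega>" "strictly_convex \<Omega>"
    and "continuous_on (closure \<Omega>) f" "bounded (f ` closure \<Omega>)"
    and "continuous_on (closure (- \<Omega>)) g" "bounded (g ` closure (- \<Omega>))"
    and "visc_subsolution s \<Omega> f g u"
    and "visc_supersolution s \<Omega> f g v"
  shows "\<forall>x. u x \<le> v x"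
proof
  fix x
  have "open \<Omega>"
    using assms(4) by (simp add: C2_domain_def)
  then have g: "continuous_on (- \<Omega>) g" "bounded (g ` (- \<Omega>))"
    using assms(8,9) by (simp_all add: closure_closed closed_Compl)
  obtain U C where U: "dirichlet_extension s \<Omega> g U C" "subsolution_every_direction s \<Omega> f g U"
    and u_le: "u x \<le> U x"
    using visc_subsolution_extension[OF assms(1-3) \<open>open \<Omega>\<close> assms(5) g assms(10)] by metis
  obtain V D where V: "dirichlet_extension s \<Omega> (\<lambda>x. - g x) V D"
    "subsolution_some_direction s \<Omega> (\<lambda>x. - f x) (\<lambda>x. - g x) V" and v_le: "- v x \<le> V x"
    using visc_supersolution_extension[OF assms(1-3) \<open>open \<Omega>\<close> assms(5) g assms(11)] by metis
  show "u x \<le> v x"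
    using comparison[OF U V assms(6), of x] u_le v_le by linarith
qed

end
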